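(* Consider the construction described in the context. For $(\lambda,\mu)=(1,1)$, construction data exist, and every graph $\overline{\Gamma}$ arising from them is isomorphic to the $3\times 3$ rook graph. For $(\lambda,\mu)=(1,3)$, Neumaier graphs $\overline{\Gamma}$ do arise from the construction, and every Neumaier graph $\overline{\Gamma}$ arising from it is isomorphic to the complement of the Schläfli graph (equivalently, to the collinearity graph of the unique generalized quadrangle of order $(2,4)$).
   Context: Graphs are finite, simple and undirected. For $k\ge 1$, a $k$-regular graph on $v\ge 2$ vertices is edge-regular with parameters $(v,k,\lambda)$ if any two adjacent vertices have exactly $\lambda$ common neighbours. A Neumaier graph is an edge-regular graph having a nonempty clique $C$ such that every vertex outside $C$ is adjacent to a constant number of vertices of $C$. The $3\times 3$ rook graph is the Cartesian product $K_3\,\square\,K_3$. The complement of the Schläfli graph is the unique (up to isomorphism) strongly regular graph with parameters $(27,10,1,5)$. Construction data with parameters $(\lambda,\mu)$, where $\lambda,\mu$ are positive integers with $\mu\mid(\lambda+2)$. Put $n:=\mu\lambda(\lambda+2)$, $k:=\lambda(\mu+1)$, $\nu:=(\lambda+2)/\mu$. The data consist of the following. - Three vertex-disjoint edge-regular graphs $\Gamma_i=(V_i,E_i)$, $i\in\{1,2,3\}$, each with parameters $(n,k,\lambda)$. - For each $i$, a partition $\Omega_i$ of $V_i$ into $\nu$ sets of size $\mu^2\lambda$, and two partitions $\mathcal{P}_i,\mathcal{P}_i'$ of $V_i$ into $\mu\nu$ independent sets of $\Gamma_i$ of size $\mu\lambda$, such that every element of $\Omega_i$ is the union of $\mu$ elements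 of $\mathcal{P}_i$ and also the union of $\mu$ elements of $\mathcal{P}_i'$, and such that whenever $\omega\in\Omega_i$, $P\in\mathcal{P}_i$, $P'\in\mathcal{P}_i'$ satisfy $P,P'\subseteq\omega$, then $|P\cap P'|=\lambda$. - Three admissible bijections $\varphi_{12}:\mathcal{P}_1\to\mathcal{P}_2'$, $\varphi_{23}:\mathcal{P}_2\to\mathcal{P}_3'$, $\varphi_{31}:\mathcal{P}_3\to\mathcal{P}_1'$. Here a bijection $\varphi:\mathcal{P}_i\to\mathcal{P}_j'$ ($i\ne j$) is admissible if for every $\omega=P_1\cup\dots\cup P_\mu\in\Omega_i$ with $P_1,\dots,P_\mu\in\mathcal{P}_i$, the set $\omega^\varphi:=P_1^\varphi\cup\dots\cup P_\mu^\varphi$ belongs to $\Omega_j$; so $\varphi$ induces a map $\Omega_i\to\Omega_j$. It is required that the composition of the induced maps $\Omega_1\to\Omega_2\to\Omega_3\to\Omega_1$ (of $\varphi_{12}$, then $\varphi_{23}$, then $\varphi_{31}$) is the identity on $\Omega_1$. The graph $\overline{\Gamma}$ has vertex set $V_1\cup V_2\cup V_3$. Two vertices of the same $V_i$ are adjacent in $\overline{\Gamma}$ iff they are adjacent in $\Gamma_i$. For $(i,j)\in\{(1,2),(2,3),(3,1)\}$, a vertex $v\in V_i$ and a vertex $w\in V_j$ are adjacent iff $w\in\varphi_{ij}(P)$, where $P$ is the unique element of $\mathcal{P}_i$ containing $v$. *)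

theory Defs
  imports "Graph_Theory.Graph_Theory" "HOL-Library.Disjoint_Sets"
begin

section \<open>Finite simple graphs\<close>

text \<open>
  A finite simple undirected graph is a \<^locale>\<open>pair_graph\<close>: a finite vertex set together with
  a symmetric, irreflexive set of ordered pairs of vertices. Isomorphism is
  \<^const>\<open>digraph_iso\<close> of the corresponding digraphs, which for such graphs is the usual
  isomorphism of simple graphs.
\<close>

definition nbrs :: "'a pair_pre_digraph \<Rightarrow> 'a \<Rightarrow> 'a set" where
  "nbrs G v = {w. (v, w) \<in> parcs G}"

abbreviation graph_iso :: "'a pair_pre_digraph \<Rightarrow> 'b pair_pre_digraph \<Rightarrow> bool" where
  "graph_iso G H \<equiv> digraph_iso (with_proj G) (with_proj H)"

definition edge_regular :: "nat \<Rightarrow> nat \<Rightarrow> nat \<Rightarrow> 'a pair_pre_digraph \<Rightarrow> bool" where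
  "edge_regular v k l G \<longleftrightarrow>
     pair_graph G \<and> v \<ge> 2 \<and> k \<ge> 1 \<and> card (pverts G) = v \<and>
     (\<forall>x \<in> pverts G. card (nbrs G x) = k) \<and>
     (\<forall>x y. (x, y) \<in> parcs G \<longrightarrow> card (nbrs G x \<inter> nbrs G y) = l)"

definition strongly_regular :: "nat \<Rightarrow> nat \<Rightarrow> nat \<Rightarrow> nat \<Rightarrow> 'a pair_pre_digraph \<Rightarrow> bool" where
  "strongly_regular v k l m G \<longleftrightarrow>
     edge_regular v k l G \<and>
     (\<forall>x \<in> pverts G. \<forall>y \<in> pverts G. x \<noteq> y \<and> (x, y) \<notin> parcs G \<longrightarrow>
        card (nbrs G x \<inter> nbrs G y) = m)"

definition is_clique :: "'a pair_pre_digraph \<Rightarrow> 'a set \<Rightarrow> bool" where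
  "is_clique G C \<longleftrightarrow> C \<subseteq> pverts G \<and> (\<forall>x \<in> C. \<forall>y \<in> C. x \<noteq> y \<longrightarrow> (x, y) \<in> parcs G)"

definition independent_set :: "'a pair_pre_digraph \<Rightarrow> 'a set \<Rightarrow> bool" where
  "independent_set G S \<longleftrightarrow> S \<subseteq> pverts G \<and> (\<forall>x \<in> S. \<forall>y \<in> S. (x, y) \<notin> parcs G)"

definition neumaier_graph :: "'a pair_pre_digraph \<Rightarrow> bool" where
  "neumaier_graph G \<longleftrightarrow>
     (\<exists>v k l. edge_regular v k l G) \<and>
     (\<exists>C e. is_clique G C \<and> C \<noteq> {} \<and> (\<forall>x \<in> pverts G - C. card (nbrs G x \<inter> C) = e))"

definition complete_graph :: "'a set \<Rightarrow> 'a pair_pre_digraph" where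
  "complete_graph V = \<lparr>pverts = V, parcs = {(x, y). x \<in> V \<and> y \<in> V \<and> x \<noteq> y}\<rparr>"

definition cartesian_product ::
    "'a pair_pre_digraph \<Rightarrow> 'b pair_pre_digraph \<Rightarrow> ('a \<times> 'b) pair_pre_digraph" where
  "cartesian_product G H =
     \<lparr>pverts = pverts G \<times> pverts H,
      parcs = {((x, y), (x', y')).
                 (x = x' \<and> x \<in> pverts G \<and> (y, y') \<in> parcs H) \<or>
                 ((x, x') \<in> parcs G \<and> y = y' \<and> y \<in> pverts H)}\<rparr>"

definition rook_graph_3_3 :: "(nat \<times> nat) pair_pre_digraph" where
  "rook_graph_3_3 = cartesian_product (complete_graph {0..<3}) (complete_graph {0..<3})"

section \<open>Generalized quadrangles\<close>

text \<open>
  A line is identified with the set of points incident with it. This loses no generality, since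
  distinct lines of a generalized quadrangle of order (s,t) with s positive are incident with
  distinct sets of points.
\<close>

definition generalized_quadrangle :: "nat \<Rightarrow> nat \<Rightarrow> 'a set \<Rightarrow> 'a set set \<Rightarrow> bool" where
  "generalized_quadrangle s t X \<L> \<longleftrightarrow>
     finite X \<and> X \<noteq> {} \<and> s \<ge> 1 \<and> t \<ge> 1 \<and> (\<forall>L \<in> \<L>. L \<subseteq> X) \<and>
     (\<forall>x \<in> X. card {L \<in> \<L>. x \<in> L} = t + 1) \<and>
     (\<forall>x \<in> X. \<forall>y \<in> X. x \<noteq> y \<longrightarrow> card {L \<in> \<L>. x \<in> L \<and> y \<in> L} \<le> 1) \<and>
     (\<forall>L \<in> \<L>. card L = s + 1) \<and>
     (\<forall>L \<in> \<L>. \<forall>M \<in> \<L>. L \<noteq> M \<longrightarrow> card (L \<inter> M) \<le> 1) \<and>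
     (\<forall>x \<in> X. \<forall>L \<in> \<L>. x \<notin> L \<longrightarrow> (\<exists>!(y, M). M \<in> \<L> \<and> x \<in> M \<and> y \<in> M \<and> y \<in> L))"

definition incidence_iso :: "'a set \<Rightarrow> 'a set set \<Rightarrow> 'b set \<Rightarrow> 'b set set \<Rightarrow> bool" where
  "incidence_iso X \<L> Y \<M> \<longleftrightarrow> (\<exists>f. bij_betw f X Y \<and> (\<lambda>L. f ` L) ` \<L> = \<M>)"

definition collinearity_graph :: "'a set \<Rightarrow> 'a set set \<Rightarrow> 'a pair_pre_digraph" where
  "collinearity_graph X \<L> =
     \<lparr>pverts = X,
      parcs = {(x, y). x \<in> X \<and> y \<in> X \<and> x \<noteq> y \<and> (\<exists>L \<in> \<L>. x \<in> L \<and> y \<in> L)}\<rparr>"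

section \<open>The construction\<close>

text \<open>
  All families are indexed by 1, 2, 3 (values at other indices are never used), and the three
  bijections \<open>\<phi>\<^sub>1\<^sub>2\<close>, \<open>\<phi>\<^sub>2\<^sub>3\<close>, \<open>\<phi>\<^sub>3\<^sub>1\<close> are \<open>\<phi> 1\<close>, \<open>\<phi> 2\<close>, \<open>\<phi> 3\<close>.
\<close>

definition succ3 :: "nat \<Rightarrow> nat" where
  "succ3 i = i mod 3 + 1"

text \<open>
  As \<open>\<P>\<close> is a partition, the parts contained in a union \<open>\<omega>\<close> of parts are exactly the parts of
  which \<open>\<omega>\<close> is the union.
\<close>

definition induced_map :: "'a set set \<Rightarrow> ('a set \<Rightarrow> 'a set) \<Rightarrow> 'a set \<Rightarrow> 'a set" where
  "induced_map \<P> \<phi> \<omega> = \<Union> (\<phi> ` {P \<in> \<P>. P \<subseteq> \<omega>})"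

definition admissible ::
    "'a set set \<Rightarrow> 'a set set \<Rightarrow> 'a set set \<Rightarrow> 'a set set \<Rightarrow> ('a set \<Rightarrow> 'a set) \<Rightarrow> bool" where
  "admissible \<Omega> \<P> \<Omega>' \<P>' \<phi> \<longleftrightarrow>
     bij_betw \<phi> \<P> \<P>' \<and> (\<forall>\<omega> \<in> \<Omega>. induced_map \<P> \<phi> \<omega> \<in> \<Omega>')"

definition construction_data ::
    "nat \<Rightarrow> nat \<Rightarrow> (nat \<Rightarrow> 'a pair_pre_digraph) \<Rightarrow> (nat \<Rightarrow> 'a set set) \<Rightarrow>
     (nat \<Rightarrow> 'a set set) \<Rightarrow> (nat \<Rightarrow> 'a set set) \<Rightarrow> (nat \<Rightarrow> 'a set \<Rightarrow> 'a set) \<Rightarrow> bool" where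
  "construction_data l m \<Gamma> \<Omega> \<P> \<P>' \<phi> \<longleftrightarrow>
     l > 0 \<and> m > 0 \<and> m dvd l + 2 \<and>
     (let n = m * l * (l + 2); k = l * (m + 1); \<nu> = (l + 2) div m in
       (\<forall>i \<in> {1,2,3}. edge_regular n k l (\<Gamma> i)) \<and>
       (\<forall>i \<in> {1,2,3}. \<forall>j \<in> {1,2,3}. i \<noteq> j \<longrightarrow> pverts (\<Gamma> i) \<inter> pverts (\<Gamma> j) = {}) \<and>
       (\<forall>i \<in> {1,2,3}.
          partition_on (pverts (\<Gamma> i)) (\<Omega> i) \<and> card (\<Omega> i) = \<nu> \<and>
          (\<forall>\<omega> \<in> \<Omega> i. card \<omega> = m\<^sup>2 * l) \<and>
          (\<forall>\<Q> \<in> {\<P> i, \<P>' i}.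
             partition_on (pverts (\<Gamma> i)) \<Q> \<and> card \<Q> = m * \<nu> \<and>
             (\<forall>P \<in> \<Q>. independent_set (\<Gamma> i) P \<and> card P = m * l) \<and>
             (\<forall>\<omega> \<in> \<Omega> i. \<exists>\<S> \<subseteq> \<Q>. card \<S> = m \<and> \<omega> = \<Union> \<S>)) \<and>
          (\<forall>\<omega> \<in> \<Omega> i. \<forall>P \<in> \<P> i. \<forall>P' \<in> \<P>' i.
             P \<subseteq> \<omega> \<and> P' \<subseteq> \<omega> \<longrightarrow> card (P \<inter> P') = l)) \<and>
       (\<forall>i \<in> {1,2,3}. admissible (\<Omega> i) (\<P> i) (\<Omega> (succ3 i)) (\<P>' (succ3 i)) (\<phi> i)) \<and>
       (\<forall>\<omega> \<in> \<Omega> 1.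
          induced_map (\<P> 3) (\<phi> 3) (induced_map (\<P> 2) (\<phi> 2) (induced_map (\<P> 1) (\<phi> 1) \<omega>)) = \<omega>))"

definition cross_arcs :: "'a set set \<Rightarrow> ('a set \<Rightarrow> 'a set) \<Rightarrow> ('a \<times> 'a) set" where
  "cross_arcs \<P> \<phi> = {(v, w). \<exists>P \<in> \<P>. v \<in> P \<and> w \<in> \<phi> P}"

definition Gamma_bar ::
    "(nat \<Rightarrow> 'a pair_pre_digraph) \<Rightarrow> (nat \<Rightarrow> 'a set set) \<Rightarrow> (nat \<Rightarrow> 'a set \<Rightarrow> 'a set) \<Rightarrow>
     'a pair_pre_digraph" where
  "Gamma_bar \<Gamma> \<P> \<phi> =
     \<lparr>pverts = (\<Union>i \<in> {1,2,3}. pverts (\<Gamma> i)),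
      parcs = (\<Union>i \<in> {1,2,3}.
        parcs (\<Gamma> i) \<union> cross_arcs (\<P> i) (\<phi> i) \<union> (cross_arcs (\<P> i) (\<phi> i))\<inverse>)\<rparr>"

end

theory Submission
  imports Defs
begin

text \<open>
The case (1,3) rests on the fact that an edge-regular graph with parameters (27,10,1) is the same
thing as a generalized quadrangle of order (2,4), and that there is only one. The key is
\<open>triangle_nexus\<close>: a count shows that every vertex outside a triangle is adjacent to exactly one
vertex of it. It gives the projection axiom for the triangles as lines, the value \<open>\<mu> = 5\<close>, and
regularity of the triangles as cliques.

Uniqueness is proved by coordinates. Fix a vertex \<open>z0\<close>. Each of the 16 vertices not adjacent to
\<open>z0\<close> picks one of the two other vertices on each of the five triangles through \<open>z0\<close>, which makes
it a 5-bit code. Two adjacent such vertices agree in exactly one bit, and for each bit there is a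
neighbour that agrees exactly there. Changing four bits preserves parity, so by counting the
codes are exactly the 16 even ones once the bits are normalised, and adjacency is read off from
the codes (\<open>coordinates\<close>). Conversely a generalized quadrangle of order (2,4) has an
edge-regular collinearity graph with parameters (27,10,1) whose triangles are its lines, so its
uniqueness follows.

Gluing three graphs for \<open>(\<lambda>,\<mu>) = (1,3)\<close> leaves one block in each \<open>\<Omega>\<close>, so parts of the two
partitions always meet in one vertex, and \<open>edge_regular_G\<close> computes the parameters
(27,10,1). Data exist on three copies of the \<open>3 \<times> 3\<close> grid with its two families of broken
diagonals. For (1,1) the glued graph is three triangles joined by matchings whose composition is
the identity, and this is visibly the rook graph.
\<close>

section \<open>Vertex maps as isomorphisms\<close>

text \<open>
Isomorphisms in the sense of \<^const>\<open>digraph_iso\<close> carry separate maps on vertices, arcs and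
end points. For graphs whose arcs are pairs the vertex map determines the rest, so only
vertex maps are handled below.
\<close>

definition graph_bij :: "('a \<Rightarrow> 'b) \<Rightarrow> 'a pair_pre_digraph \<Rightarrow> 'b pair_pre_digraph \<Rightarrow> bool" where
  "graph_bij f G H \<longleftrightarrow> bij_betw f (pverts G) (pverts H) \<and>
     (\<forall>x \<in> pverts G. \<forall>y \<in> pverts G. (x, y) \<in> parcs G \<longleftrightarrow> (f x, f y) \<in> parcs H)"

lemma graph_bij_inverse:
  assumes "graph_bij f G H"
  shows "graph_bij (the_inv_into (pverts G) f) H G"
proof -
  have b: "bij_betw f (pverts G) (pverts H)"
    using assms by (simp add: graph_bij_def)
  then have "bij_betw (the_inv_into (pverts G) f) (pverts H) (pverts G)"
    by (rule bij_betw_the_inv_into)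
  moreover from this have "the_inv_into (pverts G) f y \<in> pverts G" if "y \<in> pverts H" for y
    using that by (rule bij_betw_apply)
  moreover have "f (the_inv_into (pverts G) f y) = y" if "y \<in> pverts H" for y
    by (rule f_the_inv_into_f_bij_betw[OF b]) (use that in blast)
  ultimately show ?thesis
    using assms unfolding graph_bij_def by simp
qed

lemma graph_bij_compose:
  assumes "graph_bij f G H" "graph_bij g H K"
  shows "graph_bij (g \<circ> f) G K"
proof -
  have "bij_betw f (pverts G) (pverts H)" using assms by (simp add: graph_bij_def)
  then have "f x \<in> pverts H" if "x \<in> pverts G" for x using that by (rule bij_betw_apply)
  then show ?thesis
    using assms unfolding graph_bij_def by (auto intro: bij_betw_trans)
qed

lemma graph_iso_if_graph_bij:
  assumes "pair_wf_digraph G" "pair_wf_digraph H" and f: "graph_bij f G H"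
  shows "graph_iso G H"
proof -
  interpret G: pair_wf_digraph G by fact
  interpret H: pair_wf_digraph H by fact
  define h where "h = \<lparr>iso_verts = f, iso_arcs = map_prod f f, iso_head = snd, iso_tail = fst\<rparr>"
  have inj: "inj_on f (pverts G)" and img: "f ` pverts G = pverts H"
    using f by (auto simp: graph_bij_def bij_betw_def)
  have wf: "wf_digraph (with_proj G)" by unfold_locales
  have sub: "parcs G \<subseteq> pverts G \<times> pverts G"
    using G.arc_fst_in_verts G.arc_snd_in_verts by fastforce
  have "inj_on (map_prod f f) (parcs G)"
    using map_prod_inj_on[OF inj inj] sub by (rule inj_on_subset)
  then have "pre_digraph.digraph_isomorphism (with_proj G) h"
    using inj wf by (auto simp: pre_digraph.digraph_isomorphism_def h_def)
  moreover have "map_prod f f ` parcs G = parcs H"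
  proof
    show "map_prod f f ` parcs G \<subseteq> parcs H"
      using f sub by (auto simp: graph_bij_def)
    show "parcs H \<subseteq> map_prod f f ` parcs G"
    proof
      fix e assume e: "e \<in> parcs H"
      then obtain x y where "fst e = f x" "snd e = f y" "x \<in> pverts G" "y \<in> pverts G"
        using img H.arc_fst_in_verts H.arc_snd_in_verts by (metis imageE)
      moreover from this have "(x, y) \<in> parcs G"
        using f e by (metis graph_bij_def prod.collapse)
      ultimately show "e \<in> map_prod f f ` parcs G"
        by (metis image_eqI map_prod_simp prod.collapse)
    qed
  qed
  then have "with_proj H = app_iso h (with_proj G)"
    using img by (simp add: app_iso_def h_def with_proj_def)
  ultimately show ?thesis unfolding digraph_iso_def by blast
qed

lemma pair_graphI:
  assumes "finite (pverts G)" "parcs G \<subseteq> pverts G \<times> pverts G"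
    and "\<And>x. (x, x) \<notin> parcs G" "\<And>x y. (x, y) \<in> parcs G \<Longrightarrow> (y, x) \<in> parcs G"
  shows "pair_graph G"
proof unfold_locales
  show "finite (parcs G)" using assms(1,2) by (meson finite_SigmaI finite_subset)
  show "symmetric (with_proj G)"
    using assms(4) by (auto simp: symmetric_def intro: symI)
qed (use assms in \<open>auto; fastforce\<close>)+

lemma pair_graphD:
  assumes "pair_graph G"
  shows "finite (pverts G)" "(x, y) \<in> parcs G \<Longrightarrow> x \<in> pverts G \<and> y \<in> pverts G"
    "(x, x) \<notin> parcs G" "(x, y) \<in> parcs G \<Longrightarrow> (y, x) \<in> parcs G"
    "pair_wf_digraph G"
proof -
  interpret pair_graph G by fact
  show "finite (pverts G)" by (rule pair_finite_verts)
  show "(x, y) \<in> parcs G \<Longrightarrow> x \<in> pverts G \<and> y \<in> pverts G"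
    using arc_fst_in_verts arc_snd_in_verts by fastforce
  show "(x, x) \<notin> parcs G" using pair_no_loops by fastforce
  show "(x, y) \<in> parcs G \<Longrightarrow> (y, x) \<in> parcs G"
    using pair_sym_arcs by (simp add: symmetric_def symD)
  show "pair_wf_digraph G" by unfold_locales
qed

section \<open>Edge-regular graphs with parameters (27,10,1)\<close>

locale edge_regular_27_10_1 =
  fixes G :: "'a pair_pre_digraph"
  assumes regular: "edge_regular 27 10 1 G"
begin

abbreviation V where "V \<equiv> pverts G"
abbreviation adj (infix "\<sim>" 50) where "x \<sim> y \<equiv> (x, y) \<in> parcs G"
abbreviation N where "N \<equiv> nbrs G"

lemma graph: "pair_graph G"
  using regular by (simp add: edge_regular_def)

lemma
  shows finite_V: "finite V" and adj_V: "x \<sim> y \<Longrightarrow> x \<in> V \<and> y \<in> V"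
    and adj_irrefl [simp]: "\<not> x \<sim> x" and adj_sym: "x \<sim> y \<Longrightarrow> y \<sim> x"
  using pair_graphD[OF graph] by auto

lemma adj_commute: "x \<sim> y \<longleftrightarrow> y \<sim> x"
  using adj_sym by blast

lemma N_iff [simp]: "y \<in> N x \<longleftrightarrow> x \<sim> y"
  by (simp add: nbrs_def)

lemma card_V: "card V = 27"
  using regular by (simp add: edge_regular_def)

lemma card_N: "x \<in> V \<Longrightarrow> card (N x) = 10"
  using regular by (simp add: edge_regular_def)

lemma finite_N: "finite (N x)"
  by (rule finite_subset[OF _ finite_V]) (auto dest: adj_V)

lemma ex1_common_neighbour:
  assumes "x \<sim> y"
  shows "\<exists>!z. x \<sim> z \<and> y \<sim> z"
proof -
  have "card (N x \<inter> N y) = 1"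
    using regular assms by (simp add: edge_regular_def)
  then obtain z where "N x \<inter> N y = {z}" by (auto simp: card_1_singleton_iff)
  then have "x \<sim> u \<and> y \<sim> u \<longleftrightarrow> u = z" for u
    by (metis IntI IntD1 IntD2 N_iff singleton_iff)
  then show ?thesis by auto
qed

definition third :: "'a \<Rightarrow> 'a \<Rightarrow> 'a" where
  "third x y = (THE z. x \<sim> z \<and> y \<sim> z)"

lemma third: "x \<sim> y \<Longrightarrow> x \<sim> third x y \<and> y \<sim> third x y"
  unfolding third_def by (rule theI') (rule ex1_common_neighbour)

lemma third_unique: "x \<sim> y \<Longrightarrow> x \<sim> z \<Longrightarrow> y \<sim> z \<Longrightarrow> third x y = z"
  using ex1_common_neighbour third by blast

lemma third_third: "x \<sim> y \<Longrightarrow> third x (third x y) = y"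
  using third third_unique adj_sym by metis

text \<open>
A counting argument. A vertex outside the triangle has at most one neighbour in it, since two
would be adjacent vertices with a second common neighbour. So the vertices of the triangle have
disjoint sets of 8 neighbours outside it, and \<open>3 + 3 * 8 = 27\<close> leaves no vertex uncovered.
This is the projection axiom of a generalized quadrangle, with the triangles as lines.
\<close>

lemma triangle_nexus:
  assumes xy: "x \<sim> y" and yz: "y \<sim> z" and xz: "x \<sim> z" and w: "w \<in> V" "w \<notin> {x, y, z}"
  shows "\<exists>!u. u \<in> {x, y, z} \<and> w \<sim> u"
proof -
  have V: "x \<in> V" "y \<in> V" "z \<in> V" using assms adj_V by blast+
  have ne: "x \<noteq> y" "y \<noteq> z" "x \<noteq> z" using assms by auto
  have only: "u = x" if "y \<sim> u" "z \<sim> u" for u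
    using ex1_common_neighbour[OF yz] that xy xz adj_sym by blast
  have only': "u = y" if "x \<sim> u" "z \<sim> u" for u
    using ex1_common_neighbour[OF xz] that xy yz adj_sym by blast
  have only'': "u = z" if "x \<sim> u" "y \<sim> u" for u
    using ex1_common_neighbour[OF xy] that xz yz adj_sym by blast
  let ?A = "N x - {y, z}" and ?B = "N y - {x, z}" and ?C = "N z - {x, y}"
  have c: "card ?A = 8" "card ?B = 8" "card ?C = 8"
    using V xy xz yz ne by (simp_all add: card_Diff_subset card_N adj_sym)
  have d: "?A \<inter> ?B = {}" "(?A \<union> ?B) \<inter> ?C = {}" "(?A \<union> ?B \<union> ?C) \<inter> {x, y, z} = {}"
    by (auto dest: only only' only'')
  have "card (?A \<union> ?B \<union> ?C \<union> {x, y, z}) = 27"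
    using d c finite_N ne by (simp add: card_Un_disjoint)
  moreover have "?A \<union> ?B \<union> ?C \<union> {x, y, z} \<subseteq> V"
    using V adj_V by auto
  ultimately have "?A \<union> ?B \<union> ?C \<union> {x, y, z} = V"
    using finite_V card_V by (metis card_subset_eq)
  then have "w \<in> ?A \<union> ?B \<union> ?C" using w by blast
  then have "w \<sim> x \<or> w \<sim> y \<or> w \<sim> z" using adj_sym by auto
  moreover have "\<not> (w \<sim> x \<and> w \<sim> y)" "\<not> (w \<sim> x \<and> w \<sim> z)" "\<not> (w \<sim> y \<and> w \<sim> z)"
    using only only' only'' w adj_sym by blast+
  ultimately show ?thesis by (elim disjE) blast+
qed

lemma third_nexus:
  assumes xy: "x \<sim> y" and w: "w \<in> V" "w \<noteq> x" "\<not> x \<sim> w"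
  shows "w \<sim> third x y \<longleftrightarrow> \<not> w \<sim> y"
proof -
  have t: "x \<sim> third x y" "y \<sim> third x y" using third xy by auto
  have ne: "w \<notin> {x, y, third x y}" "y \<noteq> third x y" "\<not> w \<sim> x"
    using w xy t adj_sym by auto
  obtain u where u: "u \<in> {x, y, third x y}" "w \<sim> u"
      "\<And>v. v \<in> {x, y, third x y} \<Longrightarrow> w \<sim> v \<Longrightarrow> v = u"
    using triangle_nexus[OF xy t(2) t(1) w(1) ne(1)] by metis
  then show ?thesis using ne by (metis insert_iff empty_iff)
qed

text \<open>
The ten neighbours of \<open>x\<close> are paired up by the five triangles through \<open>x\<close>, and exactly one vertex
of each pair is adjacent to \<open>w\<close>.
\<close>

lemma nonadjacent_common_neighbours:
  assumes x: "x \<in> V" and w: "w \<in> V" "x \<noteq> w" "\<not> x \<sim> w"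
  shows "card (N x \<inter> N w) = 5"
proof -
  have flip: "third x y \<in> N w \<longleftrightarrow> y \<notin> N w" if "x \<sim> y" for y
    using third_nexus[OF that w(1)] w by auto
  have "bij_betw (third x) (N x \<inter> N w) (N x - N w)"
    by (rule bij_betw_byWitness[where f' = "third x"])
      (use flip third third_third in auto)
  then have "card (N x \<inter> N w) = card (N x - N w)" by (rule bij_betw_same_card)
  moreover have "card (N x) = card (N x \<inter> N w) + card (N x - N w)"
    by (rule card_Int_Diff[symmetric, THEN sym]) (rule finite_N)
  ultimately show ?thesis using card_N[OF x] by simp
qed

lemma strongly_regular: "strongly_regular 27 10 1 5 G"
  using regular nonadjacent_common_neighbours by (simp add: strongly_regular_def)

end

section \<open>Coordinates and uniqueness\<close>

text \<open>
Coordinates for the unique graph. \<open>Base\<close> is any vertex, \<open>Near i False\<close> and \<open>Near i True\<close> are the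
two other vertices of the \<open>i\<close>-th triangle through it, and each of the 16 remaining vertices is
coded by the set of those \<open>i\<close> for which it is adjacent to \<open>Near i True\<close>.
\<close>

datatype point = Base | Near nat bool | Far "nat set"

fun point_adj :: "point \<Rightarrow> point \<Rightarrow> bool" where
  "point_adj Base Base = False"
| "point_adj Base (Near i b) = True"
| "point_adj Base (Far A) = False"
| "point_adj (Near i b) Base = True"
| "point_adj (Near i b) (Near j c) = (i = j \<and> b \<noteq> c)"
| "point_adj (Near i b) (Far A) = (i \<in> A \<longleftrightarrow> b)"
| "point_adj (Far A) Base = False"
| "point_adj (Far A) (Near i b) = (i \<in> A \<longleftrightarrow> b)"
| "point_adj (Far A) (Far B) = (\<exists>!i. i < 5 \<and> (i \<in> A \<longleftrightarrow> i \<in> B))"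

definition even_sets :: "nat set set" where
  "even_sets = {A. A \<subseteq> {..<5} \<and> even (card A)}"

definition coordinate_graph :: "point pair_pre_digraph" where
  "coordinate_graph =
     \<lparr>pverts = {Base} \<union> {Near i b | i b. i < 5} \<union> Far ` even_sets,
      parcs = {(p, q). point_adj p q}\<rparr>"

lemma verts_coordinate_graph:
  "Base \<in> pverts coordinate_graph"
  "Near i c \<in> pverts coordinate_graph \<longleftrightarrow> i < 5"
  "Far A \<in> pverts coordinate_graph \<longleftrightarrow> A \<in> even_sets"
  by (auto simp: coordinate_graph_def)

lemma card_even_sets: "card even_sets = 16"
proof -
  have "even_sets = Set.filter (\<lambda>A. even (card A)) (Pow {..<5})"
    by (auto simp: even_sets_def)
  also have "card \<dots> = 16" by code_simp
  finally show ?thesis .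
qed

lemma card_coordinate_graph:
  "finite (pverts coordinate_graph)" "card (pverts coordinate_graph) \<le> 27"
proof -
  have fin: "finite even_sets" by (rule card_ge_0_finite) (simp add: card_even_sets)
  let ?N = "(\<lambda>(i, b). Near i b) ` ({..<5} \<times> UNIV)"
  have eq: "pverts coordinate_graph = insert Base (?N \<union> Far ` even_sets)"
    by (auto simp: coordinate_graph_def)
  show "finite (pverts coordinate_graph)" using fin by (simp add: eq)
  have "card ?N \<le> 10" by (rule order_trans[OF card_image_le]) simp_all
  moreover have "card (Far ` even_sets) \<le> 16"
    using card_image_le[OF fin, of Far] by (simp add: card_even_sets)
  ultimately have "card (?N \<union> Far ` even_sets) \<le> 26"
    using card_Un_le[of ?N "Far ` even_sets"] by linarith
  then show "card (pverts coordinate_graph) \<le> 27"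
    using fin by (simp add: eq card_insert_if)
qed

lemma even_sets_induct [consumes 1, case_names empty step]:
  assumes "A \<in> even_sets" and "P {}"
    and step: "\<And>A i j. A \<in> even_sets \<Longrightarrow> P A \<Longrightarrow> i < 5 \<Longrightarrow> j < 5 \<Longrightarrow> i \<noteq> j \<Longrightarrow> i \<notin> A \<Longrightarrow> j \<notin> A
      \<Longrightarrow> P (insert i (insert j A))"
  shows "P A"
  using assms(1)
proof (induction "card A" arbitrary: A rule: less_induct)
  case less
  have A: "A \<subseteq> {..<5}" "even (card A)" using less.prems by (auto simp: even_sets_def)
  then have fin: "finite A" using finite_subset by blast
  show ?case
  proof (cases "A = {}")
    case False
    then obtain i where i: "i \<in> A" by blast
    have "A \<noteq> {i}" using A by auto
    then obtain j where j: "j \<in> A" "j \<noteq> i" using i by blast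
    let ?B = "A - {i, j}"
    have eq: "A = insert i (insert j ?B)" using i j by blast
    have c: "card A = Suc (Suc (card ?B))"
      by (subst eq) (use fin j in simp)
    then have "?B \<in> even_sets" using A by (auto simp: even_sets_def)
    moreover from this have "P ?B" using c by (intro less.hyps) simp_all
    ultimately have "P (insert i (insert j ?B))"
      using i j A by (intro step) auto
    then show ?thesis by (rule ssubst[OF eq])
  qed (use assms in simp)
qed

text \<open>
A frame: a base vertex \<open>z0\<close>, a vertex \<open>x0\<close> not adjacent to it, and a numbering of their common
neighbours. Letting these common neighbours be the vertices \<open>Near i False\<close> gives \<open>x0\<close> the empty
set as its code, so that only even sets occur as codes.
\<close>

locale framed = edge_regular_27_10_1 +
  fixes z0 x0 :: 'a and a :: "nat \<Rightarrow> 'a"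
  assumes z0: "z0 \<in> V" and x0: "x0 \<in> V" and z0_x0: "z0 \<noteq> x0" "\<not> z0 \<sim> x0"
    and a: "bij_betw a {..<5} (N z0 \<inter> N x0)"
begin

definition b :: "nat \<Rightarrow> 'a" where "b i = third z0 (a i)"

lemma a_adj: "i < 5 \<Longrightarrow> z0 \<sim> a i" "i < 5 \<Longrightarrow> x0 \<sim> a i"
  using bij_betw_apply[OF a, of i] by auto

lemma b_adj: "i < 5 \<Longrightarrow> z0 \<sim> b i" "i < 5 \<Longrightarrow> a i \<sim> b i"
  using third[OF a_adj(1)] by (auto simp: b_def)

lemma far_one_neighbour:
  assumes "w \<in> V" "w \<noteq> z0" "\<not> z0 \<sim> w" "i < 5"
  shows "w \<sim> a i \<longleftrightarrow> \<not> w \<sim> b i"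
  using third_nexus[OF a_adj(1)[OF assms(4)] assms(1-3)] by (auto simp: b_def)

lemma a_inj: "i < 5 \<Longrightarrow> j < 5 \<Longrightarrow> a i = a j \<longleftrightarrow> i = j"
  using a by (auto simp: bij_betw_def inj_on_def)

lemma b_inj: "i < 5 \<Longrightarrow> j < 5 \<Longrightarrow> b i = b j \<longleftrightarrow> i = j"
  using third_third[OF a_adj(1)] a_inj by (metis b_def)

lemma a_neq_b: "i < 5 \<Longrightarrow> j < 5 \<Longrightarrow> a i \<noteq> b j"
  using far_one_neighbour[of x0 j] x0 z0_x0 a_adj by metis

lemma N_z0: "N z0 = a ` {..<5} \<union> b ` {..<5}"
proof (rule sym, rule card_subset_eq[OF finite_N])
  show "a ` {..<5} \<union> b ` {..<5} \<subseteq> N z0" using a_adj b_adj by auto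
  have "card (a ` {..<5}) = 5" "card (b ` {..<5}) = 5"
    using a_inj b_inj by (simp_all add: card_image inj_on_def)
  moreover have "a ` {..<5} \<inter> b ` {..<5} = {}" using a_neq_b by auto
  ultimately show "card (a ` {..<5} \<union> b ` {..<5}) = card (N z0)"
    by (simp only: card_N[OF z0] card_Un_disjoint finite_imageI finite_lessThan)
qed

definition near :: "nat \<Rightarrow> bool \<Rightarrow> 'a" where "near i c = (if c then b i else a i)"

lemma z0_adj_near: "i < 5 \<Longrightarrow> z0 \<sim> near i c"
  using a_adj b_adj by (simp add: near_def)

lemma near_inj: "i < 5 \<Longrightarrow> j < 5 \<Longrightarrow> near i c = near j d \<longleftrightarrow> i = j \<and> c = d"
  by (cases c; cases d)
    (simp_all add: near_def a_inj b_inj a_neq_b a_neq_b[THEN not_sym])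

lemma near_cases:
  assumes "z0 \<sim> u"
  obtains i c where "i < 5" "u = near i c"
proof -
  have "u \<in> a ` {..<5} \<union> b ` {..<5}" using assms N_iff N_z0 by blast
  then show thesis using that[of _ True] that[of _ False] by (auto simp: near_def)
qed

definition far where "far = V - {z0} - N z0"

definition D :: "'a \<Rightarrow> nat set" where "D w = {i. i < 5 \<and> w \<sim> b i}"

lemma far_iff: "w \<in> far \<longleftrightarrow> w \<in> V \<and> w \<noteq> z0 \<and> \<not> z0 \<sim> w"
  by (auto simp: far_def)

lemma card_far: "card far = 16"
proof -
  have "N z0 \<subseteq> V - {z0}" using adj_V by auto
  then show ?thesis
    unfolding far_def using finite_V finite_N card_V card_N[OF z0] z0
    by (simp add: card_Diff_subset)
qed

lemma near_adj_far: "w \<in> far \<Longrightarrow> i < 5 \<Longrightarrow> w \<sim> near i c \<longleftrightarrow> (i \<in> D w \<longleftrightarrow> c)"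
  using far_one_neighbour[of w i] by (auto simp: far_iff D_def near_def)

text \<open>
If the triangle on two adjacent far vertices meets the neighbourhood of \<open>z0\<close> in
\<open>near i c\<close>, then \<open>near i c\<close> is their only common neighbour. Agreement of the two codes at \<open>j\<close>
would make a vertex of the \<open>j\<close>-th triangle through \<open>z0\<close> another one.
\<close>

lemma agree_once:
  assumes w: "w \<in> far" and y: "y \<in> far" and i: "i < 5"
    and wy: "w \<sim> y" and t: "third w y = near i c"
  shows "j < 5 \<and> (j \<in> D w \<longleftrightarrow> j \<in> D y) \<longleftrightarrow> j = i"
proof -
  have *: "w \<sim> third w y" "y \<sim> third w y" using third[OF wy] by auto
  then have ci: "i \<in> D w \<longleftrightarrow> c" "i \<in> D y \<longleftrightarrow> c"
    using near_adj_far w y i unfolding t by blast+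
  show ?thesis
  proof (cases "j < 5 \<and> (j \<in> D w \<longleftrightarrow> j \<in> D y)")
    case True
    let ?u = "near j (j \<in> D w)"
    have "w \<sim> ?u" "y \<sim> ?u" using near_adj_far w y True by blast+
    then have "near i c = ?u" using third_unique[OF wy] t by simp
    then show ?thesis using True i near_inj by blast
  qed (use ci i in auto)
qed

lemma far_adj_agree:
  assumes w: "w \<in> far" and y: "y \<in> far" and wy: "w \<sim> y"
  shows "\<exists>!i. i < 5 \<and> (i \<in> D w \<longleftrightarrow> i \<in> D y)"
proof -
  have "z0 \<sim> third w y"
    using third_nexus[OF wy z0] w y adj_sym unfolding far_iff by blast
  then obtain i c where i: "i < 5" "third w y = near i c"
    by (rule near_cases)
  show ?thesis
    by (rule ex1I[of _ i]) (simp_all only: agree_once[OF w y i(1) wy i(2)])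
qed

text \<open>
The neighbour is the third vertex of the triangle through \<open>w\<close> and its neighbour on the \<open>i\<close>-th
triangle through \<open>z0\<close>.
\<close>

lemma flip:
  assumes w: "w \<in> far" and i: "i < 5"
  obtains y where "y \<in> far" "w \<sim> y" "\<forall>j. j < 5 \<and> (j \<in> D w \<longleftrightarrow> j \<in> D y) \<longleftrightarrow> j = i"
proof -
  let ?p = "near i (i \<in> D w)"
  have wp: "w \<sim> ?p" using near_adj_far w i by blast
  have op: "z0 \<sim> ?p" using z0_adj_near i by blast
  let ?y = "third w ?p"
  have t: "w \<sim> ?y" "?p \<sim> ?y" using third[OF wp] by auto
  have "?y \<noteq> z0" using t(1) w adj_sym unfolding far_iff by metis
  moreover have "\<not> z0 \<sim> ?y"
    using third_nexus[OF wp z0] w op adj_sym unfolding far_iff by blast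
  ultimately have y: "?y \<in> far" using t adj_V far_iff by blast
  have "third w ?y = ?p" by (rule third_third[OF wp])
  with that[OF y t(1)] show thesis using agree_once[OF w y i t(1)] by blast
qed

text \<open>
Complementing a code outside \<open>i\<close> and then outside \<open>j\<close> changes it exactly at \<open>i\<close> and \<open>j\<close>, and
such changes lead from the code \<open>{}\<close> of \<open>x0\<close> to every even set.
\<close>

lemma even_sets_subset: "even_sets \<subseteq> D ` far"
proof
  fix A assume "A \<in> even_sets"
  then show "A \<in> D ` far"
  proof (induction A rule: even_sets_induct)
    case empty
    have x: "x0 \<in> far" using x0 z0_x0 by (auto simp: far_iff)
    have "D x0 = {}" using far_one_neighbour[of x0] x0 z0_x0 a_adj by (auto simp: D_def)
    then show ?case using x by blast
  next
    case (step A i j)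
    then obtain w where w: "w \<in> far" "A = D w" by blast
    obtain y where y: "y \<in> far" "w \<sim> y" "\<forall>k. k < 5 \<and> (k \<in> D w \<longleftrightarrow> k \<in> D y) \<longleftrightarrow> k = i"
      by (rule flip[OF w(1) \<open>i < 5\<close>])
    obtain z where z: "z \<in> far" "y \<sim> z" "\<forall>k. k < 5 \<and> (k \<in> D y \<longleftrightarrow> k \<in> D z) \<longleftrightarrow> k = j"
      by (rule flip[OF y(1) \<open>j < 5\<close>])
    have "k \<in> D z \<longleftrightarrow> k \<in> insert i (insert j A)" for k
    proof (cases "k < 5")
      case True
      then show ?thesis using spec[OF y(3), of k] spec[OF z(3), of k] w step by auto
    next
      case False
      then show ?thesis using w step by (auto simp: D_def)
    qed
    then show ?case using z(1) by blast
  qed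
qed

text \<open>
There are 16 far vertices and 16 even sets, so a map that hits every even set is a bijection
onto them.
\<close>

lemma D_bij: "bij_betw D far even_sets"
proof -
  have fin: "finite far" using finite_V by (simp add: far_def)
  have "D ` far = even_sets"
    using even_sets_subset card_image_le[OF fin, of D] card_far card_even_sets fin
    by (metis card_seteq finite_imageI)
  then show ?thesis
    using fin card_far card_even_sets by (simp add: bij_betw_def eq_card_imp_inj_on)
qed

text \<open>
The neighbours of \<open>w\<close> among the far vertices are the five flips of \<open>w\<close>, which are determined
by their codes. Hence the codes determine adjacency.
\<close>

lemma far_adj_iff:
  assumes w: "w \<in> far" and y: "y \<in> far"
  shows "w \<sim> y \<longleftrightarrow> (\<exists>!i. i < 5 \<and> (i \<in> D w \<longleftrightarrow> i \<in> D y))"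
proof
  assume "\<exists>!i. i < 5 \<and> (i \<in> D w \<longleftrightarrow> i \<in> D y)"
  then obtain i where i: "\<And>j. j < 5 \<and> (j \<in> D w \<longleftrightarrow> j \<in> D y) \<longleftrightarrow> j = i" by metis
  then have "i < 5" by blast
  obtain y' where y': "y' \<in> far" "w \<sim> y'"
      "\<forall>j. j < 5 \<and> (j \<in> D w \<longleftrightarrow> j \<in> D y') \<longleftrightarrow> j = i"
    by (rule flip[OF w \<open>i < 5\<close>])
  have "j \<in> D y \<longleftrightarrow> j \<in> D y'" for j
    using i[of j] spec[OF y'(3), of j] by (cases "j < 5") (auto simp: D_def)
  then have "D y = D y'" by blast
  then have "y = y'" using D_bij y y'(1) by (auto simp: bij_betw_def dest: inj_onD)
  then show "w \<sim> y" using y' by simp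
qed (rule far_adj_agree[OF w y])

definition realize :: "point \<Rightarrow> 'a" where
  "realize p = (case p of Base \<Rightarrow> z0 | Near i c \<Rightarrow> near i c
     | Far A \<Rightarrow> the_inv_into far D A)"

lemma realize_Far:
  assumes "A \<in> even_sets"
  shows "realize (Far A) \<in> far" "D (realize (Far A)) = A"
  using bij_betw_apply[OF bij_betw_the_inv_into[OF D_bij] assms]
    f_the_inv_into_f_bij_betw[OF D_bij] assms
  by (auto simp: realize_def)

lemma near_adj_near:
  assumes "i < 5" "j < 5"
  shows "near i c \<sim> near j d \<longleftrightarrow> i = j \<and> c \<noteq> d"
    (is "?x \<sim> ?y \<longleftrightarrow> _")
proof
  assume xy: "?x \<sim> ?y"
  have "z0 \<sim> ?x" "z0 \<sim> ?y" using z0_adj_near assms by auto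
  with xy have "third z0 ?x = ?y" using third_unique by blast
  moreover have "third z0 ?x = near i (\<not> c)"
    using third_third[OF a_adj(1)] assms by (simp add: near_def b_def)
  ultimately have "near i (\<not> c) = ?y" by simp
  then show "i = j \<and> c \<noteq> d" using near_inj[OF assms] by blast
next
  assume "i = j \<and> c \<noteq> d"
  then show "?x \<sim> ?y" using b_adj assms adj_sym by (cases c; cases d) (simp_all add: near_def)
qed

lemma realize_Near: "i < 5 \<Longrightarrow> z0 \<sim> realize (Near i c)"
  using z0_adj_near by (simp add: realize_def)

text \<open>
A surjection between two sets of \<open>1 + 10 + 16 = 27\<close> elements is injective.
\<close>

lemma realize_graph_bij: "graph_bij realize coordinate_graph G"
  unfolding graph_bij_def
proof (intro conjI ballI)
  have surj: "realize ` pverts coordinate_graph = V"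
  proof
    have "realize Base \<in> V" using z0 by (simp add: realize_def)
    moreover have "realize (Near i c) \<in> V" if "i < 5" for i c
      using adj_V[OF realize_Near[OF that]] ..
    moreover have "realize (Far A) \<in> V" if "A \<in> even_sets" for A
      using realize_Far(1)[OF that] by (simp add: far_def)
    ultimately show "realize ` pverts coordinate_graph \<subseteq> V"
      by (auto simp: coordinate_graph_def)
    show "V \<subseteq> realize ` pverts coordinate_graph"
    proof
      fix x assume x: "x \<in> V"
      then consider "x = z0" | "x \<in> N z0" | "x \<in> far" by (auto simp: far_iff)
      then show "x \<in> realize ` pverts coordinate_graph"
      proof cases
        case 1
        then have "x = realize Base" by (simp add: realize_def)
        then show ?thesis by (auto simp: coordinate_graph_def)
      next
        case 2
        then obtain i c where "i < 5" "x = realize (Near i c)"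
          using near_cases by (auto simp: realize_def)
        then show ?thesis by (auto simp: coordinate_graph_def)
      next
        case 3
        then have "D x \<in> even_sets" "x = realize (Far (D x))"
          using D_bij by (auto simp: realize_def bij_betw_def the_inv_into_f_f)
        then show ?thesis by (auto simp: coordinate_graph_def)
      qed
    qed
  qed
  then have "inj_on realize (pverts coordinate_graph)"
    using card_coordinate_graph card_V card_image_le[OF card_coordinate_graph(1), of realize]
    by (intro eq_card_imp_inj_on) simp_all
  then show "bij_betw realize (pverts coordinate_graph) V"
    using surj by (simp add: bij_betw_def)
  fix p q assume p: "p \<in> pverts coordinate_graph" and q: "q \<in> pverts coordinate_graph"
  have base: "realize Base = z0" by (simp add: realize_def)
  have near_far: "realize (Far A) \<sim> realize (Near i c) \<longleftrightarrow> (i \<in> A \<longleftrightarrow> c)"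
    if "i < 5" "A \<in> even_sets" for i c A
    using near_adj_far[of "realize (Far A)" i c] realize_Far[OF that(2)] that(1)
    by (simp add: realize_def)
  have near_near: "realize (Near i c) \<sim> realize (Near j d) \<longleftrightarrow> i = j \<and> c \<noteq> d"
    if "i < 5" "j < 5" for i c j d
    using near_adj_near[OF that] by (simp add: realize_def)
  have far_far: "realize (Far A) \<sim> realize (Far B) \<longleftrightarrow> (\<exists>!i. i < 5 \<and> (i \<in> A \<longleftrightarrow> i \<in> B))"
    if "A \<in> even_sets" "B \<in> even_sets" for A B
    using far_adj_iff realize_Far[OF that(1)] realize_Far[OF that(2)] by simp
  have base_far: "\<not> z0 \<sim> realize (Far A)" if "A \<in> even_sets" for A
    using realize_Far[OF that] by (simp add: far_iff)
  have far_base: "\<not> realize (Far A) \<sim> z0" if "A \<in> even_sets" for A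
    using base_far[OF that] adj_sym by blast
  have far_near: "realize (Near i c) \<sim> realize (Far A) \<longleftrightarrow> (i \<in> A \<longleftrightarrow> c)"
    if "i < 5" "A \<in> even_sets" for i c A
    using near_far[OF that] adj_commute by blast
  have arcs: "(p, q) \<in> parcs coordinate_graph \<longleftrightarrow> point_adj p q" for p q
    by (simp add: coordinate_graph_def)
  show "(p, q) \<in> parcs coordinate_graph \<longleftrightarrow> realize p \<sim> realize q"
    using p q
    by (cases p; cases q)
      (simp_all only: verts_coordinate_graph arcs point_adj.simps base realize_Near near_near
        near_far base_far far_far realize_Near[THEN adj_sym] far_base far_near adj_irrefl)
qed

end

theorem (in edge_regular_27_10_1) coordinates: "\<exists>f. graph_bij f coordinate_graph G"
proof -
  have "V \<noteq> {}" using card_V by auto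
  then obtain z0 where z0: "z0 \<in> V" by blast
  have "card (insert z0 (N z0)) < card V"
    using card_N[OF z0] card_V finite_N by (simp add: card_insert_if)
  then have "\<not> V \<subseteq> insert z0 (N z0)"
    using card_mono[of "insert z0 (N z0)" V] finite_N by auto
  then obtain x0 where "x0 \<in> V" "x0 \<notin> insert z0 (N z0)" by blast
  then have x: "x0 \<in> V" "z0 \<noteq> x0" "\<not> z0 \<sim> x0" by auto
  have "card (N z0 \<inter> N x0) = 5" by (rule nonadjacent_common_neighbours[OF z0 x])
  moreover have "finite (N z0 \<inter> N x0)" using finite_N by blast
  ultimately obtain a :: "nat \<Rightarrow> 'a" where "bij_betw a {..<5} (N z0 \<inter> N x0)"
    by (metis card_lessThan finite_lessThan finite_same_card_bij)
  then interpret framed G z0 x0 a by unfold_locales (use z0 x in auto)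
  show ?thesis using realize_graph_bij by blast
qed

lemma edge_regular_27_10_1_unique:
  assumes "edge_regular 27 10 1 G" "edge_regular 27 10 1 H"
  shows "\<exists>f. graph_bij f G H"
proof -
  interpret G: edge_regular_27_10_1 G by unfold_locales fact
  interpret H: edge_regular_27_10_1 H by unfold_locales fact
  show ?thesis
    using G.coordinates H.coordinates graph_bij_inverse graph_bij_compose by metis
qed

lemma edge_regular_27_10_1_iso:
  assumes G: "edge_regular 27 10 1 G" and H: "edge_regular 27 10 1 H"
  shows "graph_iso G H"
proof -
  obtain f where "graph_bij f G H" using edge_regular_27_10_1_unique[OF G H] by blast
  moreover have "pair_wf_digraph G" "pair_wf_digraph H"
    using G H pair_graphD(5) unfolding edge_regular_def by auto
  ultimately show ?thesis using graph_iso_if_graph_bij by blast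
qed

section \<open>Generalized quadrangles of order (2,4)\<close>

text \<open>
In an edge-regular graph with \<open>\<lambda> = 1\<close> the triangles play the part of lines.
\<close>

definition triangles :: "'a pair_pre_digraph \<Rightarrow> 'a set set" where
  "triangles G = {{x, y, z} | x y z. (x, y) \<in> parcs G \<and> (y, z) \<in> parcs G \<and> (x, z) \<in> parcs G}"

context edge_regular_27_10_1
begin

lemma triangle_third: "x \<sim> y \<Longrightarrow> {x, y, third x y} \<in> triangles G"
  using third unfolding triangles_def by blast

lemma triangle_eq:
  assumes "L \<in> triangles G" "x \<in> L" "y \<in> L" "x \<noteq> y"
  shows "x \<sim> y" "L = {x, y, third x y}"
proof -
  obtain p q r where L: "L = {p, q, r}" "p \<sim> q" "q \<sim> r" "p \<sim> r"
    using assms(1) unfolding triangles_def by blast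
  have s: "q \<sim> p" "r \<sim> q" "r \<sim> p" using L adj_sym by blast+
  obtain z where z: "L = {x, y, z}" "x \<sim> y" "x \<sim> z" "y \<sim> z"
    using assms(2-4) L(2-4) s that[of p] that[of q] that[of r] unfolding L(1)
    by (elim insertE emptyE) (simp_all add: insert_commute)
  then show "x \<sim> y" "L = {x, y, third x y}" using third_unique by simp_all
qed

lemma card_triangle:
  assumes "L \<in> triangles G"
  shows "card L = 3"
proof -
  obtain p q r where L: "L = {p, q, r}" "p \<sim> q" "q \<sim> r" "p \<sim> r"
    using assms unfolding triangles_def by blast
  then have "p \<noteq> q" "q \<noteq> r" "p \<noteq> r" by auto
  then show ?thesis by (simp add: L)
qed

lemma triangle_subset: "L \<in> triangles G \<Longrightarrow> L \<subseteq> V"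
  unfolding triangles_def using adj_V by blast

text \<open>
The triangles through \<open>x\<close> partition its ten neighbours into pairs.
\<close>

lemma card_triangles_at:
  assumes x: "x \<in> V"
  shows "card {L \<in> triangles G. x \<in> L} = 5"
proof -
  let ?T = "{L \<in> triangles G. x \<in> L}"
  have "triangles G \<subseteq> Pow V" using triangle_subset by blast
  then have fin: "finite ?T" using finite_V by (auto intro: finite_subset)
  have "N x = (\<Union>L \<in> ?T. L - {x})"
  proof (intro equalityI subsetI)
    fix y assume "y \<in> N x"
    then have "x \<sim> y" "x \<noteq> y" by auto
    then show "y \<in> (\<Union>L \<in> ?T. L - {x})" using triangle_third by blast
  next
    fix y assume "y \<in> (\<Union>L \<in> ?T. L - {x})"
    then show "y \<in> N x" using triangle_eq(1) by auto
  qed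
  then have "10 = card (\<Union>L \<in> ?T. L - {x})" using card_N[OF x] by simp
  also have "\<dots> = (\<Sum>L \<in> ?T. card (L - {x}))"
  proof (rule card_UN_disjoint[OF fin])
    show "\<forall>L \<in> ?T. finite (L - {x})"
      using triangle_subset finite_V finite_subset by blast
    show "\<forall>L \<in> ?T. \<forall>M \<in> ?T. L \<noteq> M \<longrightarrow> (L - {x}) \<inter> (M - {x}) = {}"
      using triangle_eq(2) by blast
  qed
  also have "\<dots> = (\<Sum>L \<in> ?T. 2)"
    by (rule sum.cong) (auto simp: card_triangle)
  finally show ?thesis by simp
qed

text \<open>
Two adjacent vertices lie in one triangle only, and \<open>triangle_nexus\<close> is the projection axiom.
\<close>

lemma generalized_quadrangle_triangles: "generalized_quadrangle 2 4 V (triangles G)"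
  unfolding generalized_quadrangle_def
proof (intro conjI ballI impI)
  show "V \<noteq> {}" using card_V by auto
  fix x L assume L: "L \<in> triangles G"
  show "L \<subseteq> V" by (rule triangle_subset[OF L])
  show "card L = 2 + 1" using card_triangle[OF L] by simp
  assume x: "x \<in> V" "x \<notin> L"
  have "\<exists>!u. u \<in> L \<and> x \<sim> u"
  proof -
    obtain p q r where "L = {p, q, r}" "p \<sim> q" "q \<sim> r" "p \<sim> r"
      using L unfolding triangles_def by blast
    then show ?thesis using triangle_nexus[of p q r x] x by simp
  qed
  then obtain u where u: "u \<in> L" "x \<sim> u" "\<And>v. v \<in> L \<Longrightarrow> x \<sim> v \<Longrightarrow> v = u" by metis
  show "\<exists>!(y, M). M \<in> triangles G \<and> x \<in> M \<and> y \<in> M \<and> y \<in> L"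
  proof (rule ex1I[of _ "(u, {x, u, third x u})"])
    show "case (u, {x, u, third x u}) of
        (y, M) \<Rightarrow> M \<in> triangles G \<and> x \<in> M \<and> y \<in> M \<and> y \<in> L"
      using triangle_third[OF u(2)] u(1) by simp
    fix p assume p: "case p of (y, M) \<Rightarrow> M \<in> triangles G \<and> x \<in> M \<and> y \<in> M \<and> y \<in> L"
    obtain y M where yM: "p = (y, M)" by force
    have *: "M \<in> triangles G" "x \<in> M" "y \<in> M" "y \<in> L" "x \<noteq> y" using p yM x by auto
    have "y = u" using u(3) *(4) triangle_eq(1)[OF *(1-3,5)] by blast
    then show "p = (u, {x, u, third x u})" using triangle_eq(2)[OF *(1-3,5)] yM by simp
  qed
next
  fix x y :: 'a assume "x \<noteq> y"
  then have "{L \<in> triangles G. x \<in> L \<and> y \<in> L} \<subseteq> {{x, y, third x y}}"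
    using triangle_eq(2) by blast
  then show "card {L \<in> triangles G. x \<in> L \<and> y \<in> L} \<le> 1"
    by (rule card_mono[THEN order_trans, rotated]) simp_all
next
  fix L M assume LM: "L \<in> triangles G" "M \<in> triangles G" "L \<noteq> M"
  have "x = y" if "x \<in> L \<inter> M" "y \<in> L \<inter> M" for x y
    using that LM triangle_eq(2) by blast
  moreover have "finite (L \<inter> M)" using LM triangle_subset finite_V finite_subset by blast
  ultimately show "card (L \<inter> M) \<le> 1" by (simp add: card_le_Suc0_iff_eq)
qed (simp_all add: finite_V card_triangles_at)

lemma collinearity_graph_triangles: "collinearity_graph V (triangles G) = G"
proof -
  have "x \<in> V \<and> y \<in> V \<and> x \<noteq> y \<and> (\<exists>L \<in> triangles G. x \<in> L \<and> y \<in> L) \<longleftrightarrow> x \<sim> y" for x y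
  proof
    assume "x \<sim> y"
    moreover from this have "x \<noteq> y" by auto
    ultimately show "x \<in> V \<and> y \<in> V \<and> x \<noteq> y \<and> (\<exists>L \<in> triangles G. x \<in> L \<and> y \<in> L)"
      using adj_V triangle_third by blast
  qed (use triangle_eq(1) in blast)
  then show ?thesis unfolding collinearity_graph_def by simp
qed

lemma neumaier: "neumaier_graph G"
proof -
  have "V \<noteq> {}" using card_V by auto
  then obtain x where "x \<in> V" by blast
  then have "N x \<noteq> {}" using card_N[of x] by force
  then obtain y where xy: "x \<sim> y" by (auto simp: nbrs_def)
  let ?C = "{x, y, third x y}"
  have t: "x \<sim> third x y" "y \<sim> third x y" using third[OF xy] by auto
  have "card (N w \<inter> ?C) = 1" if w: "w \<in> V - ?C" for w
  proof -
    obtain u where u: "u \<in> ?C \<and> w \<sim> u" "\<And>v. v \<in> ?C \<and> w \<sim> v \<Longrightarrow> v = u"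
      using triangle_nexus[OF xy t(2,1)] w by (metis DiffD1 DiffD2)
    have "N w \<inter> ?C = {u}"
    proof (intro equalityI subsetI)
      fix v assume "v \<in> N w \<inter> ?C"
      then show "v \<in> {u}" using u(2)[of v] by simp
    next
      fix v assume "v \<in> {u}"
      then show "v \<in> N w \<inter> ?C" using u(1) by simp
    qed
    then show ?thesis by simp
  qed
  moreover have "is_clique G ?C"
    unfolding is_clique_def using triangle_subset[OF triangle_third[OF xy]]
      triangle_eq(1)[OF triangle_third[OF xy]] by blast
  moreover have "?C \<noteq> {}" by simp
  ultimately show ?thesis unfolding neumaier_graph_def using regular by blast
qed

end

lemma triangles_image:
  assumes wf: "pair_wf_digraph G" "pair_wf_digraph H" and f: "graph_bij f G H"
  shows "(\<lambda>L. f ` L) ` triangles G = triangles H"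
proof -
  interpret G: pair_wf_digraph G by fact
  interpret H: pair_wf_digraph H by fact
  have VG: "x \<in> pverts G \<and> y \<in> pverts G" if "(x, y) \<in> parcs G" for x y
    using G.arc_fst_in_verts[OF that] G.arc_snd_in_verts[OF that] by simp
  have VH: "x \<in> pverts H \<and> y \<in> pverts H" if "(x, y) \<in> parcs H" for x y
    using H.arc_fst_in_verts[OF that] H.arc_snd_in_verts[OF that] by simp
  have arc: "(f x, f y) \<in> parcs H \<longleftrightarrow> (x, y) \<in> parcs G" if "x \<in> pverts G" "y \<in> pverts G" for x y
    using f that by (simp add: graph_bij_def)
  have img: "f ` pverts G = pverts H" using f by (simp add: graph_bij_def bij_betw_def)
  show ?thesis
  proof (intro equalityI subsetI)
    fix M assume "M \<in> (\<lambda>L. f ` L) ` triangles G"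
    then obtain x y z where "M = {f x, f y, f z}"
        and a: "(x, y) \<in> parcs G" "(y, z) \<in> parcs G" "(x, z) \<in> parcs G"
      unfolding triangles_def by auto
    moreover have "(f x, f y) \<in> parcs H" "(f y, f z) \<in> parcs H" "(f x, f z) \<in> parcs H"
      using a arc VG by blast+
    ultimately show "M \<in> triangles H" unfolding triangles_def by blast
  next
    fix M assume "M \<in> triangles H"
    then obtain p q r where M: "M = {p, q, r}"
        and a: "(p, q) \<in> parcs H" "(q, r) \<in> parcs H" "(p, r) \<in> parcs H"
      unfolding triangles_def by auto
    then have "p \<in> f ` pverts G" "q \<in> f ` pverts G" "r \<in> f ` pverts G" using VH img by blast+
    then obtain x y z where xyz: "x \<in> pverts G" "y \<in> pverts G" "z \<in> pverts G"
        "p = f x" "q = f y" "r = f z" by blast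
    then have "{x, y, z} \<in> triangles G" using a arc unfolding triangles_def by blast
    moreover have "M = f ` {x, y, z}" using M xyz by simp
    ultimately show "M \<in> (\<lambda>L. f ` L) ` triangles G" by blast
  qed
qed

locale quadrangle_2_4 =
  fixes Y :: "'a set" and \<M> :: "'a set set"
  assumes gq: "generalized_quadrangle 2 4 Y \<M>"
begin

abbreviation H where "H \<equiv> collinearity_graph Y \<M>"

lemma
  shows finite_Y: "finite Y" and nonempty_Y: "Y \<noteq> {}"
    and line_subset: "L \<in> \<M> \<Longrightarrow> L \<subseteq> Y" and card_line: "L \<in> \<M> \<Longrightarrow> card L = 3"
    and card_lines_at: "x \<in> Y \<Longrightarrow> card {L \<in> \<M>. x \<in> L} = 5"
    and card_meet: "L \<in> \<M> \<Longrightarrow> M \<in> \<M> \<Longrightarrow> L \<noteq> M \<Longrightarrow> card (L \<inter> M) \<le> 1"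
    and project: "x \<in> Y \<Longrightarrow> L \<in> \<M> \<Longrightarrow> x \<notin> L \<Longrightarrow>
      (\<exists>!(y, M). M \<in> \<M> \<and> x \<in> M \<and> y \<in> M \<and> y \<in> L)"
  using gq by (simp_all add: generalized_quadrangle_def)

lemma finite_line: "L \<in> \<M> \<Longrightarrow> finite L"
  using line_subset finite_Y finite_subset by blast

lemma line_unique:
  assumes "L \<in> \<M>" "M \<in> \<M>" "x \<in> L" "x \<in> M" "y \<in> L" "y \<in> M" "x \<noteq> y"
  shows "L = M"
proof (rule ccontr)
  assume "L \<noteq> M"
  moreover have "finite (L \<inter> M)" using finite_line assms by blast
  ultimately show False
    using card_meet[OF assms(1,2)] assms(3-7) by (auto simp: card_le_Suc0_iff_eq)
qed

lemma arc_iff: "(x, y) \<in> parcs H \<longleftrightarrow> x \<noteq> y \<and> (\<exists>L \<in> \<M>. x \<in> L \<and> y \<in> L)"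
  using line_subset by (auto simp: collinearity_graph_def)

lemma project_unique:
  assumes "L \<in> \<M>" "w \<in> Y" "w \<notin> L" "x \<in> L" "y \<in> L" "(w, x) \<in> parcs H" "(w, y) \<in> parcs H"
  shows "x = y"
proof -
  obtain A B where AB: "A \<in> \<M>" "w \<in> A" "x \<in> A" "B \<in> \<M>" "w \<in> B" "y \<in> B"
    using assms(6,7) by (auto simp: arc_iff)
  obtain p where p: "\<And>q. (case q of (y, M) \<Rightarrow> M \<in> \<M> \<and> w \<in> M \<and> y \<in> M \<and> y \<in> L) \<Longrightarrow> q = p"
    using project[OF assms(2,1,3)] by blast
  have "(x, A) = p" "(y, B) = p" using p[of "(x, A)"] p[of "(y, B)"] AB assms by simp_all
  then show ?thesis by auto
qed

lemma project_exists:
  assumes "L \<in> \<M>" "w \<in> Y" "w \<notin> L"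
  obtains x where "x \<in> L" "(w, x) \<in> parcs H"
proof -
  obtain p where "case p of (y, M) \<Rightarrow> M \<in> \<M> \<and> w \<in> M \<and> y \<in> M \<and> y \<in> L"
    using project[OF assms(2,1,3)] by blast
  then show thesis using that assms by (auto simp: arc_iff split: prod.splits)
qed

lemma pair_graph: "pair_graph H"
  by (rule pair_graphI) (auto simp: finite_Y collinearity_graph_def)

lemma arc_sym: "(x, y) \<in> parcs H \<Longrightarrow> (y, x) \<in> parcs H"
  by (auto simp: arc_iff)

lemma card_nbrs:
  assumes "x \<in> Y"
  shows "card (nbrs H x) = 10"
proof -
  let ?T = "{L \<in> \<M>. x \<in> L}"
  have fin: "finite ?T" by (rule card_ge_0_finite) (simp add: card_lines_at[OF assms])
  have "nbrs H x = (\<Union>L \<in> ?T. L - {x})" by (auto simp: nbrs_def arc_iff)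
  also have "card \<dots> = (\<Sum>L \<in> ?T. card (L - {x}))"
  proof (rule card_UN_disjoint[OF fin])
    show "\<forall>L \<in> ?T. finite (L - {x})" using finite_line by blast
    show "\<forall>L \<in> ?T. \<forall>M \<in> ?T. L \<noteq> M \<longrightarrow> (L - {x}) \<inter> (M - {x}) = {}"
      using line_unique by blast
  qed
  also have "\<dots> = (\<Sum>L \<in> ?T. 2)" by (rule sum.cong) (auto simp: card_line)
  finally show ?thesis using card_lines_at[OF assms] by simp
qed

text \<open>
A common neighbour off the line \<open>L\<close> would be collinear with two points of \<open>L\<close>, against the
projection axiom.
\<close>

lemma common_nbrs:
  assumes L: "L \<in> \<M>" "x \<in> L" "y \<in> L" "x \<noteq> y"
  shows "nbrs H x \<inter> nbrs H y = L - {x, y}"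
proof (intro equalityI subsetI)
  fix w assume "w \<in> nbrs H x \<inter> nbrs H y"
  then have w: "(w, x) \<in> parcs H" "(w, y) \<in> parcs H" by (auto simp: nbrs_def arc_sym)
  then have "w \<in> Y" using line_subset by (auto simp: arc_iff)
  then have "w \<in> L" using project_unique[OF L(1) _ _ L(2,3) w] L(4) by blast
  then show "w \<in> L - {x, y}" using w by (auto simp: arc_iff)
qed (use L in \<open>auto simp: nbrs_def arc_iff\<close>)

text \<open>
Every point off a line \<open>L\<close> is collinear with exactly one point of \<open>L\<close>, and each point of \<open>L\<close> has
\<open>10 - 2 = 8\<close> neighbours off \<open>L\<close>.
\<close>

lemma card_Y: "card Y = 27"
proof -
  obtain x where x: "x \<in> Y" using nonempty_Y by blast
  have "{L \<in> \<M>. x \<in> L} \<noteq> {}" using card_lines_at[OF x] by force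
  then obtain L where L: "L \<in> \<M>" by blast
  let ?A = "\<lambda>u. nbrs H u - L"
  have V: "nbrs H u \<subseteq> Y" for u using line_subset by (auto simp: nbrs_def arc_iff)
  have "card (\<Union>u \<in> L. ?A u) = (\<Sum>u \<in> L. card (?A u))"
  proof (rule card_UN_disjoint[OF finite_line[OF L]])
    show "\<forall>u \<in> L. finite (?A u)" using V finite_Y finite_subset by blast
    show "\<forall>u \<in> L. \<forall>v \<in> L. u \<noteq> v \<longrightarrow> ?A u \<inter> ?A v = {}"
      using project_unique[OF L] V arc_sym unfolding nbrs_def by blast
  qed
  also have "\<dots> = (\<Sum>u \<in> L. 8)"
  proof (rule sum.cong)
    fix u assume u: "u \<in> L"
    have "?A u = nbrs H u - (L - {u})" by (auto simp: nbrs_def arc_iff)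
    moreover have "L - {u} \<subseteq> nbrs H u" using L u by (auto simp: nbrs_def arc_iff)
    ultimately show "card (?A u) = 8"
      using card_nbrs[of u] line_subset[OF L] u finite_line[OF L] card_line[OF L]
      by (simp add: card_Diff_subset subset_eq)
  qed simp
  also have "\<dots> = 24" using card_line[OF L] by simp
  finally have 24: "card (\<Union>u \<in> L. ?A u) = 24" .
  have "w \<in> (\<Union>u \<in> L. ?A u)" if w: "w \<in> Y" "w \<notin> L" for w
    using project_exists[OF L w] w arc_sym unfolding nbrs_def by blast
  then have "Y = L \<union> (\<Union>u \<in> L. ?A u)" using line_subset[OF L] V by blast
  moreover have "finite (\<Union>u \<in> L. ?A u)"
    by (rule finite_subset[OF _ finite_Y]) (use V in blast)
  moreover have "L \<inter> (\<Union>u \<in> L. ?A u) = {}" by blast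
  ultimately have "card Y = card L + card (\<Union>u \<in> L. ?A u)"
    using card_Un_disjoint finite_line[OF L] by metis
  then show ?thesis using 24 card_line[OF L] by simp
qed

lemma edge_regular_collinearity_graph: "edge_regular 27 10 1 H"
proof -
  have "card (nbrs H x \<inter> nbrs H y) = 1" if xy: "(x, y) \<in> parcs H" for x y
  proof -
    obtain L where L: "L \<in> \<M>" "x \<in> L" "y \<in> L" "x \<noteq> y" using xy by (auto simp: arc_iff)
    have "card (L - {x, y}) = 1" using L card_line[OF L(1)] by (simp add: card_Diff_subset)
    then show ?thesis using common_nbrs[OF L] by simp
  qed
  moreover have "pverts H = Y" by (simp add: collinearity_graph_def)
  ultimately show ?thesis
    using pair_graph card_Y card_nbrs by (simp add: edge_regular_def)
qed

lemma triangles_collinearity_graph: "triangles H = \<M>"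
proof (intro equalityI subsetI)
  fix T assume "T \<in> triangles H"
  then obtain x y z where T: "T = {x, y, z}" "(x, y) \<in> parcs H" "(y, z) \<in> parcs H" "(x, z) \<in> parcs H"
    unfolding triangles_def by blast
  then obtain L where L: "L \<in> \<M>" "x \<in> L" "y \<in> L" "x \<noteq> y" by (auto simp: arc_iff)
  have "z \<in> nbrs H x \<inter> nbrs H y" using T by (simp add: nbrs_def)
  then have z: "z \<in> L - {x, y}" using common_nbrs[OF L] by simp
  have "T = L"
    by (rule card_subset_eq[OF finite_line[OF L(1)]]) (use T L z card_line[OF L(1)] in auto)
  then show "T \<in> \<M>" using L by simp
next
  fix L assume L: "L \<in> \<M>"
  obtain x y z where "L = {x, y, z}" "x \<noteq> y" "y \<noteq> z" "x \<noteq> z"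
    using card_line[OF L] unfolding card_3_iff by blast
  moreover have "(u, v) \<in> parcs H" if "u \<in> L" "v \<in> L" "u \<noteq> v" for u v
    using L that unfolding arc_iff by blast
  ultimately have "(x, y) \<in> parcs H" "(y, z) \<in> parcs H" "(x, z) \<in> parcs H" "L = {x, y, z}"
    by simp_all
  then show "L \<in> triangles H" unfolding triangles_def by blast
qed

end

lemma generalized_quadrangle_2_4_unique:
  assumes Y: "generalized_quadrangle 2 4 Y \<M>" and S: "edge_regular 27 10 1 S"
  shows "incidence_iso Y \<M> (pverts S) (triangles S)"
proof -
  interpret quadrangle_2_4 Y \<M> by unfold_locales fact
  obtain f where f: "graph_bij f H S"
    using edge_regular_27_10_1_unique[OF edge_regular_collinearity_graph S] by blast
  have "pair_wf_digraph S" using S pair_graphD(5) by (auto simp: edge_regular_def)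
  then have "(\<lambda>L. f ` L) ` \<M> = triangles S"
    using triangles_image[OF pair_graphD(5)[OF pair_graph] _ f] triangles_collinearity_graph by simp
  moreover have "bij_betw f Y (pverts S)"
    using f by (simp add: graph_bij_def collinearity_graph_def)
  ultimately show ?thesis unfolding incidence_iso_def by blast
qed

section \<open>Parameters of the glued graph\<close>

lemma succ3_values: "succ3 1 = 2" "succ3 (Suc 0) = 2" "succ3 2 = 3" "succ3 3 = 1"
  by (simp_all add: succ3_def)

lemma succ3_simps:
  assumes "i \<in> {1, 2, 3}"
  shows "succ3 i \<in> {1, 2, 3}" "succ3 (succ3 (succ3 i)) = i"
    "succ3 i \<noteq> i" "succ3 (succ3 i) \<noteq> i" "succ3 (succ3 i) \<noteq> succ3 i"
    "{1, 2, 3} = {i, succ3 i, succ3 (succ3 i)}"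
  using assms by (auto simp: succ3_values)

lemma partition_on_eq:
  assumes "partition_on A P" "p \<in> P" "q \<in> P" "x \<in> p" "x \<in> q"
  shows "p = q"
  using assms unfolding partition_on_def disjoint_def by blast

text \<open>
The part of the construction data that fixes the graph and its local structure, without the
coarse partitions \<open>\<Omega>\<close>.
\<close>

locale glued =
  fixes n k l s :: nat
    and \<Gamma> :: "nat \<Rightarrow> 'a pair_pre_digraph" and \<P> \<P>' :: "nat \<Rightarrow> 'a set set"
    and \<phi> :: "nat \<Rightarrow> 'a set \<Rightarrow> 'a set"
  assumes regular: "i \<in> {1, 2, 3} \<Longrightarrow> edge_regular n k l (\<Gamma> i)"
    and disjoint_verts: "i \<in> {1, 2, 3} \<Longrightarrow> j \<in> {1, 2, 3} \<Longrightarrow> i \<noteq> j \<Longrightarrow>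
      pverts (\<Gamma> i) \<inter> pverts (\<Gamma> j) = {}"
    and partition: "i \<in> {1, 2, 3} \<Longrightarrow> partition_on (pverts (\<Gamma> i)) (\<P> i)"
      "i \<in> {1, 2, 3} \<Longrightarrow> partition_on (pverts (\<Gamma> i)) (\<P>' i)"
    and independent: "i \<in> {1, 2, 3} \<Longrightarrow> A \<in> \<P> i \<union> \<P>' i \<Longrightarrow> independent_set (\<Gamma> i) A \<and> card A = s"
    and glue: "i \<in> {1, 2, 3} \<Longrightarrow> bij_betw (\<phi> i) (\<P> i) (\<P>' (succ3 i))"
begin

abbreviation V where "V i \<equiv> pverts (\<Gamma> i)"
abbreviation G where "G \<equiv> Gamma_bar \<Gamma> \<P> \<phi>"

lemma graph: "i \<in> {1, 2, 3} \<Longrightarrow> pair_graph (\<Gamma> i)"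
  using regular by (simp add: edge_regular_def)

lemma part_subset:
  assumes "i \<in> {1, 2, 3}"
  shows "A \<in> \<P> i \<Longrightarrow> A \<subseteq> V i" "A \<in> \<P>' i \<Longrightarrow> A \<subseteq> V i"
  using partition[OF assms] by (auto dest: partition_onD1)

lemma glued_part: "i \<in> {1, 2, 3} \<Longrightarrow> A \<in> \<P> i \<Longrightarrow> \<phi> i A \<in> \<P>' (succ3 i)"
  by (rule bij_betw_apply[OF glue])

lemma cross_verts:
  assumes "i \<in> {1, 2, 3}" "(v, w) \<in> cross_arcs (\<P> i) (\<phi> i)"
  shows "v \<in> V i" "w \<in> V (succ3 i)"
proof -
  obtain A where A: "A \<in> \<P> i" "v \<in> A" "w \<in> \<phi> i A"
    using assms(2) by (auto simp: cross_arcs_def)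
  show "v \<in> V i" using part_subset(1)[OF assms(1) A(1)] A by blast
  show "w \<in> V (succ3 i)"
    using part_subset(2)[OF succ3_simps(1)[OF assms(1)] glued_part[OF assms(1) A(1)]] A by blast
qed

lemma verts_G: "pverts G = V 1 \<union> V 2 \<union> V 3"
  by (auto simp: Gamma_bar_def)

lemma arcs_G: "(v, w) \<in> parcs G \<longleftrightarrow> (\<exists>i \<in> {1, 2, 3}. (v, w) \<in> parcs (\<Gamma> i) \<or>
    (v, w) \<in> cross_arcs (\<P> i) (\<phi> i) \<or> (w, v) \<in> cross_arcs (\<P> i) (\<phi> i))"
  by (auto simp: Gamma_bar_def)

lemma same_index:
  "v \<in> V i \<Longrightarrow> v \<in> V j \<Longrightarrow> i \<in> {1, 2, 3} \<Longrightarrow> j \<in> {1, 2, 3} \<Longrightarrow> i = j"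
  using disjoint_verts[of i j] by blast

lemma arcs_G_cases:
  assumes "(v, w) \<in> parcs G"
  obtains i where "i \<in> {1, 2, 3}" "(v, w) \<in> parcs (\<Gamma> i)"
  | i where "i \<in> {1, 2, 3}" "(v, w) \<in> cross_arcs (\<P> i) (\<phi> i)"
  | i where "i \<in> {1, 2, 3}" "(w, v) \<in> cross_arcs (\<P> i) (\<phi> i)"
  using assms unfolding arcs_G by blast

lemma pair_graph_G: "pair_graph G"
proof (rule pair_graphI)
  show "finite (pverts G)"
    using graph[THEN pair_graphD(1)] by (simp add: verts_G)
  have V: "V i \<subseteq> pverts G" if "i \<in> {1, 2, 3}" for i
    using that by (auto simp: verts_G)
  show "parcs G \<subseteq> pverts G \<times> pverts G"
  proof (rule subrelI)
    fix v w assume "(v, w) \<in> parcs G"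
    then show "(v, w) \<in> pverts G \<times> pverts G"
    proof (cases rule: arcs_G_cases)
      case (1 i)
      then show ?thesis using pair_graphD(2)[OF graph] V by blast
    next
      case (2 i)
      then show ?thesis using cross_verts[OF 2] V V[OF succ3_simps(1)] by blast
    next
      case (3 i)
      then show ?thesis using cross_verts[OF 3] V V[OF succ3_simps(1)] by blast
    qed
  qed
  show "(v, v) \<notin> parcs G" for v
  proof
    assume "(v, v) \<in> parcs G"
    then show False
    proof (cases rule: arcs_G_cases)
      case (1 i)
      then show ?thesis using pair_graphD(3)[OF graph] by blast
    next
      case (2 i)
      then show ?thesis using cross_verts[OF 2] same_index succ3_simps(1,3) by metis
    next
      case (3 i)
      then show ?thesis using cross_verts[OF 3] same_index succ3_simps(1,3) by metis
    qed
  qed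
  show "(w, v) \<in> parcs G" if "(v, w) \<in> parcs G" for v w
    using that
  proof (cases rule: arcs_G_cases)
    case (1 i)
    then show ?thesis using pair_graphD(4)[OF graph] arcs_G by blast
  qed (use arcs_G in blast)+
qed

text \<open>
A vertex of the \<open>i\<close>-th graph sees one part of the next graph and one part of the previous one.
The previous index is \<open>succ3 (succ3 i)\<close>.
\<close>

lemma nbrs_G:
  assumes i: "i \<in> {1, 2, 3}" and A: "A \<in> \<P> i" "v \<in> A"
    and B: "B \<in> \<P> (succ3 (succ3 i))" "v \<in> \<phi> (succ3 (succ3 i)) B"
  shows "nbrs G v = nbrs (\<Gamma> i) v \<union> \<phi> i A \<union> B"
proof -
  let ?h = "succ3 (succ3 i)"
  have h: "?h \<in> {1, 2, 3}" "succ3 ?h = i" using succ3_simps i by auto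
  have v: "v \<in> V i" using part_subset(1)[OF i A(1)] A(2) by blast
  have "w \<in> nbrs (\<Gamma> i) v \<union> \<phi> i A \<union> B" if "(v, w) \<in> parcs G" for w
    using that
  proof (cases rule: arcs_G_cases)
    case (1 j)
    then have "v \<in> V j" using pair_graphD(2)[OF graph] by blast
    then have "j = i" using v same_index i 1 by blast
    then show ?thesis using 1 by (simp add: nbrs_def)
  next
    case (2 j)
    then have "j = i" using same_index[OF cross_verts(1)[OF 2] v _ i] by simp
    with 2 obtain A' where A': "A' \<in> \<P> i" "v \<in> A'" "w \<in> \<phi> i A'"
      by (auto simp: cross_arcs_def)
    then have "A' = A" using partition_on_eq[OF partition(1)[OF i]] A by blast
    then show ?thesis using A' by simp
  next
    case (3 j)
    then have "succ3 j = i"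
      using same_index[OF cross_verts(2)[OF 3] v succ3_simps(1)[OF 3(1)] i] by simp
    then have "j = ?h" using succ3_simps(2)[OF 3(1)] by simp
    with 3 obtain B' where B': "B' \<in> \<P> ?h" "w \<in> B'" "v \<in> \<phi> ?h B'"
      by (auto simp: cross_arcs_def)
    have "\<phi> ?h B' \<in> \<P>' i" "\<phi> ?h B \<in> \<P>' i" using glued_part[OF h(1)] B'(1) B(1) h(2) by auto
    then have "\<phi> ?h B' = \<phi> ?h B"
      using partition_on_eq[OF partition(2)[OF i]] B(2) B'(3) by blast
    then have "B' = B"
      using glue[OF h(1)] B(1) B'(1) by (auto simp: bij_betw_def dest: inj_onD)
    then show ?thesis using B' by simp
  qed
  moreover have "(v, w) \<in> parcs G" if "w \<in> nbrs (\<Gamma> i) v \<union> \<phi> i A \<union> B" for w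
    using that i h(1) A B unfolding arcs_G nbrs_def cross_arcs_def by blast
  ultimately show ?thesis unfolding nbrs_def[of G] by blast
qed

lemma parts_at:
  assumes i: "i \<in> {1, 2, 3}" and v: "v \<in> V i"
  obtains A B where "A \<in> \<P> i" "v \<in> A" "B \<in> \<P> (succ3 (succ3 i))" "v \<in> \<phi> (succ3 (succ3 i)) B"
    "nbrs G v = nbrs (\<Gamma> i) v \<union> \<phi> i A \<union> B"
proof -
  let ?h = "succ3 (succ3 i)"
  have h: "?h \<in> {1, 2, 3}" "succ3 ?h = i" using succ3_simps i by auto
  obtain A where A: "A \<in> \<P> i" "v \<in> A" using partition_onD1[OF partition(1)[OF i]] v by blast
  obtain A' where A': "A' \<in> \<P>' i" "v \<in> A'" using partition_onD1[OF partition(2)[OF i]] v by blast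
  have "A' \<in> \<phi> ?h ` \<P> ?h" using glue[OF h(1)] A'(1) h(2) by (simp add: bij_betw_def)
  then obtain B where B: "B \<in> \<P> ?h" "v \<in> \<phi> ?h B" using A'(2) by blast
  show thesis by (rule that[OF A B nbrs_G[OF i A B]])
qed

lemma nbrs_subset: "i \<in> {1, 2, 3} \<Longrightarrow> nbrs (\<Gamma> i) v \<subseteq> V i"
  using pair_graphD(2)[OF graph] by (auto simp: nbrs_def)

lemma finite_V: "i \<in> {1, 2, 3} \<Longrightarrow> finite (V i)"
  by (rule pair_graphD(1)[OF graph])

lemma card_nbrs_G:
  assumes "v \<in> pverts G"
  shows "card (nbrs G v) = k + 2 * s"
proof -
  obtain i where i: "i \<in> {1, 2, 3}" and v: "v \<in> V i" using assms by (auto simp: verts_G)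
  note s = succ3_simps[OF i]
  let ?j = "succ3 i" and ?h = "succ3 (succ3 i)"
  have j: "?j \<in> {1, 2, 3}" and h: "?h \<in> {1, 2, 3}" using s succ3_simps(1) by blast+
  obtain A B where AB: "A \<in> \<P> i" "v \<in> A" "B \<in> \<P> ?h" "v \<in> \<phi> ?h B"
      and N: "nbrs G v = nbrs (\<Gamma> i) v \<union> \<phi> i A \<union> B"
    by (rule parts_at[OF i v])
  have A': "\<phi> i A \<in> \<P>' ?j" by (rule glued_part[OF i AB(1)])
  have sub: "nbrs (\<Gamma> i) v \<subseteq> V i" "\<phi> i A \<subseteq> V ?j" "B \<subseteq> V ?h"
    using nbrs_subset[OF i] part_subset(2)[OF j A'] part_subset(1)[OF h AB(3)] by auto
  then have fin: "finite (nbrs (\<Gamma> i) v)" "finite (\<phi> i A)" "finite B"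
    using finite_V i j h finite_subset by blast+
  have dis: "V i \<inter> V ?j = {}" "V i \<inter> V ?h = {}" "V ?j \<inter> V ?h = {}"
    using disjoint_verts i j h s by metis+
  have "nbrs (\<Gamma> i) v \<inter> \<phi> i A = {}" "(nbrs (\<Gamma> i) v \<union> \<phi> i A) \<inter> B = {}"
    using sub dis by blast+
  moreover have "card (nbrs (\<Gamma> i) v) = k" using regular[OF i] v by (simp add: edge_regular_def)
  moreover have "card (\<phi> i A) = s" "card B = s"
    using independent[OF j, of "\<phi> i A"] independent[OF h, of B] A' AB by simp_all
  ultimately show ?thesis unfolding N using fin by (simp add: card_Un_disjoint)
qed

text \<open>
Adjacent vertices of one graph lie in different parts of either partition, as the parts are
independent. So they see disjoint sets in the two other graphs.
\<close>

lemma common_nbrs_within: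
  assumes i: "i \<in> {1, 2, 3}" and vw: "(v, w) \<in> parcs (\<Gamma> i)"
  shows "card (nbrs G v \<inter> nbrs G w) = l"
proof -
  let ?j = "succ3 i" and ?h = "succ3 (succ3 i)"
  note s = succ3_simps[OF i]
  have j: "?j \<in> {1, 2, 3}" and h: "?h \<in> {1, 2, 3}" using s succ3_simps(1) by blast+
  have v: "v \<in> V i" and w: "w \<in> V i" using pair_graphD(2)[OF graph[OF i] vw] by auto
  obtain A B where A: "A \<in> \<P> i" "v \<in> A" and B: "B \<in> \<P> ?h" "v \<in> \<phi> ?h B"
      and Nv: "nbrs G v = nbrs (\<Gamma> i) v \<union> \<phi> i A \<union> B"
    by (rule parts_at[OF i v])
  obtain C D where C: "C \<in> \<P> i" "w \<in> C" and D: "D \<in> \<P> ?h" "w \<in> \<phi> ?h D"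
      and Nw: "nbrs G w = nbrs (\<Gamma> i) w \<union> \<phi> i C \<union> D"
    by (rule parts_at[OF i w])
  have A': "\<phi> i A \<in> \<P>' ?j" "\<phi> i C \<in> \<P>' ?j" using glued_part[OF i] A C by auto
  have B': "\<phi> ?h B \<in> \<P>' i" "\<phi> ?h D \<in> \<P>' i" using glued_part[OF h] B D s by auto
  have no_arc: "\<not> (v \<in> X \<and> w \<in> X)" if "X \<in> \<P> i \<union> \<P>' i" for X
    using independent[OF i that] vw by (auto simp: independent_set_def)
  have "A \<noteq> C" using no_arc[of A] A C by auto
  then have "\<phi> i A \<noteq> \<phi> i C" using glue[OF i] A C by (auto simp: bij_betw_def dest: inj_onD)
  then have 1: "\<phi> i A \<inter> \<phi> i C = {}" using partition_on_eq[OF partition(2)[OF j] A'] by blast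
  have "B \<noteq> D" using no_arc[of "\<phi> ?h B"] B D B' by auto
  then have 2: "B \<inter> D = {}" using partition_on_eq[OF partition(1)[OF h] B(1) D(1)] by blast
  have sub: "nbrs (\<Gamma> i) v \<subseteq> V i" "nbrs (\<Gamma> i) w \<subseteq> V i"
      "\<phi> i A \<subseteq> V ?j" "\<phi> i C \<subseteq> V ?j" "B \<subseteq> V ?h" "D \<subseteq> V ?h"
    using nbrs_subset[OF i] part_subset(2)[OF j] A' part_subset(1)[OF h] B D by auto
  have dis: "V i \<inter> V ?j = {}" "V i \<inter> V ?h = {}" "V ?j \<inter> V ?h = {}"
    using disjoint_verts i j h s by metis+
  have "nbrs G v \<inter> nbrs G w = nbrs (\<Gamma> i) v \<inter> nbrs (\<Gamma> i) w"
    unfolding Nv Nw using 1 2 sub dis by blast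
  then show ?thesis using regular[OF i] vw by (simp add: edge_regular_def)
qed

end

text \<open>
When \<open>\<Omega>\<close> has a single block, any part of \<open>\<P>\<close> meets any part of \<open>\<P>'\<close> in \<open>l\<close> vertices.
\<close>

locale glued_transversal = glued +
  assumes meet: "i \<in> {1, 2, 3} \<Longrightarrow> A \<in> \<P> i \<Longrightarrow> B \<in> \<P>' i \<Longrightarrow> card (A \<inter> B) = l"
begin

text \<open>
For adjacent vertices of different graphs independence removes all common neighbours in these
two graphs. In the third graph one vertex sees a part of \<open>\<P>\<close> and the other a part of \<open>\<P>'\<close>.
\<close>

lemma common_nbrs_across:
  assumes i: "i \<in> {1, 2, 3}" and vw: "(v, w) \<in> cross_arcs (\<P> i) (\<phi> i)"
  shows "card (nbrs G v \<inter> nbrs G w) = l"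
proof -
  let ?j = "succ3 i" and ?h = "succ3 (succ3 i)"
  note s = succ3_simps[OF i]
  have j: "?j \<in> {1, 2, 3}" and h: "?h \<in> {1, 2, 3}" using s succ3_simps(1) by blast+
  have v: "v \<in> V i" and w: "w \<in> V ?j" using cross_verts[OF i vw] by auto
  obtain A B where A: "A \<in> \<P> i" "v \<in> A" and B: "B \<in> \<P> ?h" "v \<in> \<phi> ?h B"
      and Nv: "nbrs G v = nbrs (\<Gamma> i) v \<union> \<phi> i A \<union> B"
    by (rule parts_at[OF i v])
  obtain A2 where A2: "A2 \<in> \<P> i" "v \<in> A2" "w \<in> \<phi> i A2" using vw by (auto simp: cross_arcs_def)
  have "A2 = A" by (rule partition_on_eq[OF partition(1)[OF i] A2(1) A(1) A2(2) A(2)])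
  then have wA: "w \<in> \<phi> i A" using A2 by simp
  obtain C where C: "C \<in> \<P> ?j" "w \<in> C" using partition_onD1[OF partition(1)[OF j]] w by blast
  have Nw: "nbrs G w = nbrs (\<Gamma> ?j) w \<union> \<phi> ?j C \<union> A"
    using nbrs_G[OF j C, of A] A wA s by simp
  have A': "\<phi> i A \<in> \<P>' ?j" by (rule glued_part[OF i A(1)])
  have C': "\<phi> ?j C \<in> \<P>' ?h" by (rule glued_part[OF j C(1)])
  have 1: "nbrs (\<Gamma> i) v \<inter> A = {}"
    using independent[OF i, of A] A by (auto simp: independent_set_def nbrs_def)
  have 2: "nbrs (\<Gamma> ?j) w \<inter> \<phi> i A = {}"
    using independent[OF j, of "\<phi> i A"] A' wA by (auto simp: independent_set_def nbrs_def)
  have sub: "nbrs (\<Gamma> i) v \<subseteq> V i" "A \<subseteq> V i" "nbrs (\<Gamma> ?j) w \<subseteq> V ?j" "\<phi> i A \<subseteq> V ?j"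
      "B \<subseteq> V ?h" "\<phi> ?j C \<subseteq> V ?h"
    using nbrs_subset i j part_subset(1)[OF i A(1)] part_subset(1)[OF h B(1)]
      part_subset(2)[OF j A'] part_subset(2)[OF h C'] by auto
  have dis: "V i \<inter> V ?j = {}" "V i \<inter> V ?h = {}" "V ?j \<inter> V ?h = {}"
    using disjoint_verts i j h s by metis+
  have "nbrs G v \<inter> nbrs G w = B \<inter> \<phi> ?j C"
    unfolding Nv Nw using 1 2 sub dis by blast
  then show ?thesis using meet[OF h B(1) C'] by simp
qed

theorem edge_regular_G: "edge_regular (3 * n) (k + 2 * s) l G"
proof -
  have c: "card (V i) = n" "n \<ge> 2" "k \<ge> 1" if "i \<in> {1, 2, 3}" for i
    using regular[OF that] by (simp_all add: edge_regular_def)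
  have "card (pverts G) = 3 * n"
    using c(1) finite_V disjoint_verts[of 1 2] disjoint_verts[of 1 3] disjoint_verts[of 2 3]
    by (simp add: verts_G card_Un_disjoint Int_Un_distrib2)
  moreover have "card (nbrs G v \<inter> nbrs G w) = l" if "(v, w) \<in> parcs G" for v w
    using that
  proof (cases rule: arcs_G_cases)
    case 1
    then show ?thesis by (rule common_nbrs_within)
  next
    case 2
    then show ?thesis by (rule common_nbrs_across)
  next
    case 3
    then show ?thesis by (subst Int_commute) (rule common_nbrs_across)
  qed
  ultimately show ?thesis
    using pair_graph_G card_nbrs_G c(2,3)[of 1] by (simp add: edge_regular_def)
qed

end

lemma construction_dataD:
  assumes "construction_data l m \<Gamma> \<Omega> \<P> \<P>' \<phi>" and i: "i \<in> {1, 2, 3}"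
  shows "edge_regular (m * l * (l + 2)) (l * (m + 1)) l (\<Gamma> i)"
    and "j \<in> {1, 2, 3} \<Longrightarrow> i \<noteq> j \<Longrightarrow> pverts (\<Gamma> i) \<inter> pverts (\<Gamma> j) = {}"
    and "partition_on (pverts (\<Gamma> i)) (\<Omega> i)" "card (\<Omega> i) = (l + 2) div m"
    and "\<omega> \<in> \<Omega> i \<Longrightarrow> card \<omega> = m\<^sup>2 * l"
    and "\<Q> \<in> {\<P> i, \<P>' i} \<Longrightarrow> partition_on (pverts (\<Gamma> i)) \<Q>"
    and "\<Q> \<in> {\<P> i, \<P>' i} \<Longrightarrow> A \<in> \<Q> \<Longrightarrow> independent_set (\<Gamma> i) A \<and> card A = m * l"
    and "\<omega> \<in> \<Omega> i \<Longrightarrow> A \<in> \<P> i \<Longrightarrow> B \<in> \<P>' i \<Longrightarrow> A \<subseteq> \<omega> \<Longrightarrow> B \<subseteq> \<omega> \<Longrightarrow> card (A \<inter> B) = l"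
    and "bij_betw (\<phi> i) (\<P> i) (\<P>' (succ3 i))"
proof -
  let ?\<nu> = "(l + 2) div m"
  have r: "\<forall>i \<in> {1,2,3}. edge_regular (m * l * (l + 2)) (l * (m + 1)) l (\<Gamma> i)"
    and j: "\<forall>i \<in> {1,2,3}. \<forall>j \<in> {1,2,3}. i \<noteq> j \<longrightarrow> pverts (\<Gamma> i) \<inter> pverts (\<Gamma> j) = {}"
    and p: "\<forall>i \<in> {1,2,3}. partition_on (pverts (\<Gamma> i)) (\<Omega> i) \<and> card (\<Omega> i) = ?\<nu> \<and>
          (\<forall>\<omega> \<in> \<Omega> i. card \<omega> = m\<^sup>2 * l) \<and>
          (\<forall>\<Q> \<in> {\<P> i, \<P>' i}.
             partition_on (pverts (\<Gamma> i)) \<Q> \<and> card \<Q> = m * ?\<nu> \<and>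
             (\<forall>P \<in> \<Q>. independent_set (\<Gamma> i) P \<and> card P = m * l) \<and>
             (\<forall>\<omega> \<in> \<Omega> i. \<exists>\<S> \<subseteq> \<Q>. card \<S> = m \<and> \<omega> = \<Union> \<S>)) \<and>
          (\<forall>\<omega> \<in> \<Omega> i. \<forall>P \<in> \<P> i. \<forall>P' \<in> \<P>' i.
             P \<subseteq> \<omega> \<and> P' \<subseteq> \<omega> \<longrightarrow> card (P \<inter> P') = l)"
    and b: "\<forall>i \<in> {1,2,3}. bij_betw (\<phi> i) (\<P> i) (\<P>' (succ3 i)) \<and>
          (\<forall>\<omega> \<in> \<Omega> i. induced_map (\<P> i) (\<phi> i) \<omega> \<in> \<Omega> (succ3 i))"
    using assms(1)[unfolded construction_data_def Let_def admissible_def]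
    by - (elim conjE, assumption)+
  show "edge_regular (m * l * (l + 2)) (l * (m + 1)) l (\<Gamma> i)" by (rule bspec[OF r i])
  show "j \<in> {1, 2, 3} \<Longrightarrow> i \<noteq> j \<Longrightarrow> pverts (\<Gamma> i) \<inter> pverts (\<Gamma> j) = {}"
    using bspec[OF j i] by blast
  show "bij_betw (\<phi> i) (\<P> i) (\<P>' (succ3 i))" using bspec[OF b i] by blast
  note p = bspec[OF p i]
  show "partition_on (pverts (\<Gamma> i)) (\<Omega> i)" "card (\<Omega> i) = ?\<nu>"
    using p by simp_all
  have \<omega>: "\<forall>\<omega> \<in> \<Omega> i. card \<omega> = m\<^sup>2 * l"
    and q: "\<forall>\<Q> \<in> {\<P> i, \<P>' i}.
             partition_on (pverts (\<Gamma> i)) \<Q> \<and> card \<Q> = m * ?\<nu> \<and>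
             (\<forall>P \<in> \<Q>. independent_set (\<Gamma> i) P \<and> card P = m * l) \<and>
             (\<forall>\<omega> \<in> \<Omega> i. \<exists>\<S> \<subseteq> \<Q>. card \<S> = m \<and> \<omega> = \<Union> \<S>)"
    and meet: "\<forall>\<omega> \<in> \<Omega> i. \<forall>P \<in> \<P> i. \<forall>P' \<in> \<P>' i.
             P \<subseteq> \<omega> \<and> P' \<subseteq> \<omega> \<longrightarrow> card (P \<inter> P') = l"
    using p by - (elim conjE, assumption)+
  show "\<omega> \<in> \<Omega> i \<Longrightarrow> card \<omega> = m\<^sup>2 * l" by (rule bspec[OF \<omega>])
  show "partition_on (pverts (\<Gamma> i)) \<Q>" if "\<Q> \<in> {\<P> i, \<P>' i}"
    using bspec[OF q that] by (elim conjE)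
  show "independent_set (\<Gamma> i) A \<and> card A = m * l" if "\<Q> \<in> {\<P> i, \<P>' i}" "A \<in> \<Q>"
  proof -
    have "\<forall>P \<in> \<Q>. independent_set (\<Gamma> i) P \<and> card P = m * l"
      using bspec[OF q that(1)] by (elim conjE)
    then show ?thesis using that(2) by (rule bspec)
  qed
  show "\<omega> \<in> \<Omega> i \<Longrightarrow> A \<in> \<P> i \<Longrightarrow> B \<in> \<P>' i \<Longrightarrow> A \<subseteq> \<omega> \<Longrightarrow> B \<subseteq> \<omega> \<Longrightarrow> card (A \<inter> B) = l"
    using meet by simp
qed

lemma construction_data_glued:
  assumes "construction_data l m \<Gamma> \<Omega> \<P> \<P>' \<phi>"
  shows "glued (m * l * (l + 2)) (l * (m + 1)) l (m * l) \<Gamma> \<P> \<P>' \<phi>"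
proof
  fix i :: nat assume i: "i \<in> {1, 2, 3}"
  note d = construction_dataD[OF assms i]
  show "edge_regular (m * l * (l + 2)) (l * (m + 1)) l (\<Gamma> i)" by (rule d)
  show "pverts (\<Gamma> i) \<inter> pverts (\<Gamma> j) = {}" if "j \<in> {1, 2, 3}" "i \<noteq> j" for j
    using that by (rule d(2))
  show "partition_on (pverts (\<Gamma> i)) (\<P> i)" "partition_on (pverts (\<Gamma> i)) (\<P>' i)"
    by (rule d(6), simp)+
  show "independent_set (\<Gamma> i) A \<and> card A = m * l" if "A \<in> \<P> i \<union> \<P>' i" for A
    using that d(7)[of "\<P> i" A] d(7)[of "\<P>' i" A] by blast
  show "bij_betw (\<phi> i) (\<P> i) (\<P>' (succ3 i))" by (rule d)
qed

text \<open>
For \<open>m = l + 2\<close> the number \<open>\<nu>\<close> of blocks of \<open>\<Omega>\<close> is 1, and the block is the whole vertex set.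
\<close>

lemma construction_data_transversal:
  assumes "construction_data l (l + 2) \<Gamma> \<Omega> \<P> \<P>' \<phi>"
  shows "glued_transversal ((l + 2) * l * (l + 2)) (l * (l + 2 + 1)) l ((l + 2) * l) \<Gamma> \<P> \<P>' \<phi>"
proof -
  interpret glued "(l + 2) * l * (l + 2)" "l * (l + 2 + 1)" l "(l + 2) * l" \<Gamma> \<P> \<P>' \<phi>
    by (rule construction_data_glued[OF assms])
  show ?thesis
  proof
    fix i :: nat and A B assume i: "i \<in> {1, 2, 3}" and AB: "A \<in> \<P> i" "B \<in> \<P>' i"
    note d = construction_dataD[OF assms i]
    have "card (\<Omega> i) = 1" "\<Union> (\<Omega> i) = V i"
      using d(3,4) by (simp_all add: partition_on_def)
    then have "V i \<in> \<Omega> i" by (auto simp: card_1_singleton_iff)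
    then show "card (A \<inter> B) = l" using d(8) AB part_subset[OF i] by blast
  qed
qed

lemma edge_regular_Gamma_bar_1_3:
  assumes "construction_data 1 3 \<Gamma> \<Omega> \<P> \<P>' \<phi>"
  shows "edge_regular 27 10 1 (Gamma_bar \<Gamma> \<P> \<phi>)"
proof -
  have "construction_data 1 (1 + 2) \<Gamma> \<Omega> \<P> \<P>' \<phi>"
    using assms by (simp add: numeral_eq_Suc)
  from glued_transversal.edge_regular_G[OF construction_data_transversal[OF this]]
  show ?thesis by simp
qed

section \<open>Existence of construction data\<close>

definition translate :: "nat \<Rightarrow> nat pair_pre_digraph \<Rightarrow> nat pair_pre_digraph" where
  "translate c G = \<lparr>pverts = (+) c ` pverts G, parcs = map_prod ((+) c) ((+) c) ` parcs G\<rparr>"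

lemma nbrs_translate: "nbrs (translate c G) (c + x) = (+) c ` nbrs G x"
  by (force simp: nbrs_def translate_def)

lemma edge_regular_translate:
  assumes "edge_regular v k l G"
  shows "edge_regular v k l (translate c G)"
proof -
  have G: "pair_graph G" "v \<ge> 2" "k \<ge> 1" "card (pverts G) = v"
    "\<And>x. x \<in> pverts G \<Longrightarrow> card (nbrs G x) = k"
    "\<And>x y. (x, y) \<in> parcs G \<Longrightarrow> card (nbrs G x \<inter> nbrs G y) = l"
    using assms by (simp_all add: edge_regular_def)
  note g = pair_graphD[OF G(1)]
  have pverts: "pverts (translate c G) = (+) c ` pverts G"
    and parcs: "parcs (translate c G) = map_prod ((+) c) ((+) c) ` parcs G"
    by (simp_all add: translate_def)
  have card: "card ((+) c ` A) = card A" for A :: "nat set" by (simp add: card_image)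
  have int: "(+) c ` A \<inter> (+) c ` B = (+) c ` (A \<inter> B)" for A B :: "nat set" by auto
  have "pair_graph (translate c G)"
    by (rule pair_graphI) (use g in \<open>auto simp: translate_def\<close>)
  then show ?thesis
    using G unfolding edge_regular_def pverts parcs
    by (auto simp: nbrs_translate card int)
qed

lemma partition_on_inj_image':
  assumes "partition_on A P" "inj f"
  shows "partition_on (f ` A) ((`) f ` P)"
proof -
  have "{} \<notin> (`) f ` P" using partition_onD3[OF assms(1)] by auto
  then show ?thesis
    using partition_on_inj_image[OF assms(1), of f] assms(2) inj_on_subset by fastforce
qed

text \<open>
Both existence claims use three shifted copies of one graph on \<open>{..<n}\<close>. The gluing bijections
come from a single permutation \<open>h\<close> of the vertices that turns \<open>\<P>\<close> into \<open>\<P>'\<close> and fixes every block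
of \<open>\<Omega>\<close>, so each induced map sends a block to its own copy and the required composition is the
identity.
\<close>

lemma construction_data_three_copies:
  fixes R :: "nat pair_pre_digraph"
  assumes pos: "l > 0" "m > 0" "m dvd l + 2"
    and n_def: "n = m * l * (l + 2)" and k_def: "k = l * (m + 1)" and \<nu>_def: "\<nu> = (l + 2) div m"
    and R: "edge_regular n k l R" "pverts R = {..<n}"
    and \<Omega>: "partition_on {..<n} \<Omega>" "card \<Omega> = \<nu>" "\<And>\<omega>. \<omega> \<in> \<Omega> \<Longrightarrow> card \<omega> = m\<^sup>2 * l"
    and parts: "\<And>\<Q>. \<Q> \<in> {\<P>, \<P>'} \<Longrightarrow> partition_on {..<n} \<Q> \<and> card \<Q> = m * \<nu>"
      "\<And>\<Q> A. \<Q> \<in> {\<P>, \<P>'} \<Longrightarrow> A \<in> \<Q> \<Longrightarrow> independent_set R A \<and> card A = m * l"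
      "\<And>\<Q> \<omega>. \<Q> \<in> {\<P>, \<P>'} \<Longrightarrow> \<omega> \<in> \<Omega> \<Longrightarrow> \<exists>\<S> \<subseteq> \<Q>. card \<S> = m \<and> \<omega> = \<Union> \<S>"
    and meet: "\<And>\<omega> A B. \<omega> \<in> \<Omega> \<Longrightarrow> A \<in> \<P> \<Longrightarrow> B \<in> \<P>' \<Longrightarrow> A \<subseteq> \<omega> \<Longrightarrow> B \<subseteq> \<omega> \<Longrightarrow> card (A \<inter> B) = l"
    and h: "inj h" "(`) h ` \<P> = \<P>'" "\<And>\<omega>. \<omega> \<in> \<Omega> \<Longrightarrow> h ` \<omega> = \<omega>"
  shows "\<exists>(\<Gamma> :: nat \<Rightarrow> nat pair_pre_digraph) \<Omega> \<P> \<P>' \<phi>. construction_data l m \<Gamma> \<Omega> \<P> \<P>' \<phi>"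
proof -
  define c :: "nat \<Rightarrow> nat \<Rightarrow> nat" where "c i = (+) (n * i)" for i
  define copies where "copies \<Q> i = (`) (c i) ` \<Q>" for \<Q> :: "nat set set" and i
  define \<Gamma> where "\<Gamma> i = translate (n * i) R" for i
  define \<phi> where "\<phi> i A = c (succ3 i) ` h ` (\<lambda>x. x - n * i) ` A" for i and A :: "nat set"
  have inj: "inj (c i)" for i by (simp add: c_def)
  have V: "pverts (\<Gamma> i) = c i ` {..<n}" for i by (simp add: \<Gamma>_def translate_def R c_def)
  have \<phi>: "\<phi> i (c i ` A) = c (succ3 i) ` h ` A" for i A
    by (simp add: \<phi>_def c_def image_image)
  have inj_image: "inj ((`) (c i))" for i using inj by (simp add: inj_on_image)
  have card_copies: "card (copies \<Q> i) = card \<Q>" for \<Q> i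
    unfolding copies_def by (rule card_image) (rule inj_on_subset[OF inj_image], simp)
  have card_copy: "card (c i ` A) = card A" for i A
    by (rule card_image) (rule inj_on_subset[OF inj], simp)
  have partition_copies: "partition_on (pverts (\<Gamma> i)) (copies \<Q> i)"
    if "partition_on {..<n} \<Q>" for \<Q> i
    unfolding V copies_def by (rule partition_on_inj_image'[OF that inj])
  have subset_copy: "c i ` A \<subseteq> c i ` B \<longleftrightarrow> A \<subseteq> B" for i A B
    by (rule inj_image_subset_iff[OF inj])
  have indep: "independent_set (\<Gamma> i) (c i ` A)" if "independent_set R A" for i A
    using that unfolding independent_set_def \<Gamma>_def translate_def c_def by auto
  have induced: "induced_map (copies \<P> i) (\<phi> i) (c i ` \<omega>) = c (succ3 i) ` \<omega>"
    if \<omega>: "\<omega> \<in> \<Omega>" for i \<omega>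
  proof -
    have "{A \<in> copies \<P> i. A \<subseteq> c i ` \<omega>} = (`) (c i) ` {A \<in> \<P>. A \<subseteq> \<omega>}"
      by (auto simp: copies_def subset_copy)
    then have "induced_map (copies \<P> i) (\<phi> i) (c i ` \<omega>) = (\<Union>A \<in> {A \<in> \<P>. A \<subseteq> \<omega>}. \<phi> i (c i ` A))"
      by (simp add: induced_map_def)
    also have "\<dots> = c (succ3 i) ` h ` \<Union> {A \<in> \<P>. A \<subseteq> \<omega>}" unfolding \<phi> by blast
    also have "\<Union> {A \<in> \<P>. A \<subseteq> \<omega>} = \<omega>"
    proof -
      obtain \<S> where "\<S> \<subseteq> \<P>" "\<omega> = \<Union> \<S>" using parts(3)[of \<P> \<omega>] \<omega> by blast
      then show ?thesis by blast
    qed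
    finally show ?thesis using h(3)[OF \<omega>] by simp
  qed
  have "construction_data l m \<Gamma> (copies \<Omega>) (copies \<P>) (copies \<P>') \<phi>"
    unfolding construction_data_def Let_def n_def[symmetric] k_def[symmetric] \<nu>_def[symmetric]
  proof (intro conjI ballI impI)
    fix i j :: nat
    show "edge_regular n k l (\<Gamma> i)"
      unfolding \<Gamma>_def by (rule edge_regular_translate[OF R(1)])
    show "pverts (\<Gamma> i) \<inter> pverts (\<Gamma> j) = {}" if "i \<noteq> j"
    proof -
      have "z div n = i" if "z \<in> pverts (\<Gamma> i)" for z i using that by (auto simp: V c_def)
      then show ?thesis using \<open>i \<noteq> j\<close> by blast
    qed
    show "partition_on (pverts (\<Gamma> i)) (copies \<Omega> i)" by (rule partition_copies[OF \<Omega>(1)])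
    show "card (copies \<Omega> i) = \<nu>" by (simp add: card_copies \<Omega>)
    show "card \<omega> = m\<^sup>2 * l" if "\<omega> \<in> copies \<Omega> i" for \<omega>
      using that \<Omega>(3) by (auto simp: copies_def card_copy)
  next
    fix i :: nat and \<Q> assume "\<Q> \<in> {copies \<P> i, copies \<P>' i}"
    then obtain \<Q>0 where Q: "\<Q> = copies \<Q>0 i" "\<Q>0 \<in> {\<P>, \<P>'}" by blast
    show "partition_on (pverts (\<Gamma> i)) \<Q>"
      unfolding Q(1) using parts(1)[OF Q(2)] by (intro partition_copies) simp
    show "card \<Q> = m * \<nu>" using parts(1)[OF Q(2)] by (simp add: Q(1) card_copies)
    show "independent_set (\<Gamma> i) A" "card A = m * l" if "A \<in> \<Q>" for A
      using that parts(2)[OF Q(2)] indep by (auto simp: Q(1) copies_def card_copy)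
    show "\<exists>\<S> \<subseteq> \<Q>. card \<S> = m \<and> \<omega> = \<Union> \<S>" if "\<omega> \<in> copies \<Omega> i" for \<omega>
    proof -
      obtain \<omega>0 where w: "\<omega>0 \<in> \<Omega>" "\<omega> = c i ` \<omega>0" using \<open>\<omega> \<in> copies \<Omega> i\<close> by (auto simp: copies_def)
      obtain \<S> where "\<S> \<subseteq> \<Q>0" "card \<S> = m" "\<omega>0 = \<Union> \<S>" using parts(3)[OF Q(2) w(1)] by blast
      then have "copies \<S> i \<subseteq> \<Q>" "card (copies \<S> i) = m" "\<omega> = \<Union> (copies \<S> i)"
        unfolding Q(1) w(2) card_copies by (auto simp: copies_def)
      then show ?thesis by blast
    qed
  next
    fix i :: nat and \<omega> A B
    assume "\<omega> \<in> copies \<Omega> i" "A \<in> copies \<P> i" "B \<in> copies \<P>' i" and "A \<subseteq> \<omega> \<and> B \<subseteq> \<omega>"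
    then obtain \<omega>0 A0 B0 where "\<omega>0 \<in> \<Omega>" "A0 \<in> \<P>" "B0 \<in> \<P>'" "A0 \<subseteq> \<omega>0" "B0 \<subseteq> \<omega>0"
        and AB: "A = c i ` A0" "B = c i ` B0"
      by (auto simp: copies_def subset_copy)
    then have "card (A0 \<inter> B0) = l" by (intro meet)
    then show "card (A \<inter> B) = l" by (simp add: AB image_Int[OF inj, symmetric] card_copy)
  next
    fix i :: nat
    have b: "bij_betw (\<phi> i) (copies \<P> i) (copies \<P>' (succ3 i))"
    proof (rule bij_betw_imageI)
      show "inj_on (\<phi> i) (copies \<P> i)"
        using inj_image_eq_iff[OF inj] inj_image_eq_iff[OF h(1)]
        by (auto simp: inj_on_def copies_def \<phi>)
      show "\<phi> i ` copies \<P> i = copies \<P>' (succ3 i)"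
        by (simp add: copies_def \<phi> image_image h(2)[symmetric])
    qed
    have "induced_map (copies \<P> i) (\<phi> i) \<omega> \<in> copies \<Omega> (succ3 i)" if "\<omega> \<in> copies \<Omega> i" for \<omega>
      using that induced by (auto simp: copies_def)
    with b show "admissible (copies \<Omega> i) (copies \<P> i) (copies \<Omega> (succ3 i)) (copies \<P>' (succ3 i)) (\<phi> i)"
      by (simp add: admissible_def)
  next
    fix \<omega> assume "\<omega> \<in> copies \<Omega> 1"
    then obtain \<omega>0 where "\<omega>0 \<in> \<Omega>" "\<omega> = c 1 ` \<omega>0" by (auto simp: copies_def)
    then show "induced_map (copies \<P> 3) (\<phi> 3) (induced_map (copies \<P> 2) (\<phi> 2)
        (induced_map (copies \<P> 1) (\<phi> 1) \<omega>)) = \<omega>"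
      using induced[of \<omega>0 1] induced[of \<omega>0 2] induced[of \<omega>0 3] by (simp add: succ3_values)
  qed (use pos in auto)
  then show ?thesis by blast
qed

definition triangle_graph :: "nat pair_pre_digraph" where
  "triangle_graph = \<lparr>pverts = {..<3}, parcs = {(x, y). x < 3 \<and> y < 3 \<and> x \<noteq> y}\<rparr>"

text \<open>
The \<open>3 \<times> 3\<close> rook graph with the cell in row \<open>a\<close> and column \<open>b\<close> numbered \<open>3 * a + b\<close>.
\<close>

definition grid_graph :: "nat pair_pre_digraph" where
  "grid_graph = \<lparr>pverts = {..<9}, parcs = {(x, y). x < 9 \<and> y < 9 \<and> x \<noteq> y \<and>
     (x div 3 = y div 3 \<or> x mod 3 = y mod 3)}\<rparr>"

lemma lessThan_9: "{..<9} = {0, 1, 2, 3, 4, 5, 6, 7, 8 :: nat}" by auto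

lemma nbrs_grid_graph:
  "nbrs grid_graph 0 = {1, 2, 3, 6}" "nbrs grid_graph 1 = {0, 2, 4, 7}" "nbrs grid_graph 2 = {0, 1, 5, 8}"
  "nbrs grid_graph 3 = {0, 4, 5, 6}" "nbrs grid_graph 4 = {1, 3, 5, 7}" "nbrs grid_graph 5 = {2, 3, 4, 8}"
  "nbrs grid_graph 6 = {0, 3, 7, 8}" "nbrs grid_graph 7 = {1, 4, 6, 8}" "nbrs grid_graph 8 = {2, 5, 6, 7}"
proof -
  have "nbrs grid_graph x =
      set (filter (\<lambda>y. x \<noteq> y \<and> (x div 3 = y div 3 \<or> x mod 3 = y mod 3)) [0, 1, 2, 3, 4, 5, 6, 7, 8])"
    if "x < 9" for x
  proof -
    have "nbrs grid_graph x = {y \<in> {..<9}. x \<noteq> y \<and> (x div 3 = y div 3 \<or> x mod 3 = y mod 3)}"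
      using that by (auto simp: nbrs_def grid_graph_def)
    also have "{..<9} = set [0, 1, 2, 3, 4, 5, 6, 7, 8 :: nat]" by (simp add: lessThan_9)
    finally show ?thesis unfolding set_filter .
  qed
  then show
    "nbrs grid_graph 0 = {1, 2, 3, 6}" "nbrs grid_graph 1 = {0, 2, 4, 7}" "nbrs grid_graph 2 = {0, 1, 5, 8}"
    "nbrs grid_graph 3 = {0, 4, 5, 6}" "nbrs grid_graph 4 = {1, 3, 5, 7}" "nbrs grid_graph 5 = {2, 3, 4, 8}"
    "nbrs grid_graph 6 = {0, 3, 7, 8}" "nbrs grid_graph 7 = {1, 4, 6, 8}" "nbrs grid_graph 8 = {2, 5, 6, 7}"
    by (simp_all del: One_nat_def)
qed

lemma edge_regular_grid_graph: "edge_regular 9 4 1 grid_graph"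
proof -
  have V: "pverts grid_graph = {0, 1, 2, 3, 4, 5, 6, 7, 8}"
    by (simp add: grid_graph_def lessThan_9)
  have deg: "\<forall>x \<in> pverts grid_graph. card (nbrs grid_graph x) = 4"
    unfolding V by (simp add: nbrs_grid_graph del: One_nat_def)
  have "\<forall>x \<in> pverts grid_graph. \<forall>y \<in> nbrs grid_graph x. card (nbrs grid_graph x \<inter> nbrs grid_graph y) = 1"
    unfolding V by (simp add: nbrs_grid_graph del: One_nat_def)
  moreover have "x \<in> pverts grid_graph \<and> y \<in> nbrs grid_graph x" if "(x, y) \<in> parcs grid_graph" for x y
    using that by (simp add: nbrs_def grid_graph_def)
  moreover have "pair_graph grid_graph" by (rule pair_graphI) (auto simp: grid_graph_def)
  moreover have "card (pverts grid_graph) = 9" by (simp add: grid_graph_def)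
  ultimately show ?thesis using deg unfolding edge_regular_def by auto
qed

lemma edge_regular_triangle_graph: "edge_regular 3 2 1 triangle_graph"
proof -
  have N: "nbrs triangle_graph x = {..<3} - {x}" if "x < 3" for x
    using that by (auto simp: nbrs_def triangle_graph_def)
  have "pair_graph triangle_graph" by (rule pair_graphI) (auto simp: triangle_graph_def)
  moreover have "card (nbrs triangle_graph x) = 2" if "x < 3" for x
    using that by (simp add: N)
  moreover have "card (nbrs triangle_graph x \<inter> nbrs triangle_graph y) = 1"
    if "x < 3" "y < 3" "x \<noteq> y" for x y
  proof -
    have "nbrs triangle_graph x \<inter> nbrs triangle_graph y = {..<3} - {x, y}" using that by (auto simp: N)
    then show ?thesis using that by (simp add: card_Diff_subset)
  qed
  ultimately show ?thesis by (simp add: edge_regular_def triangle_graph_def)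
qed

lemma construction_data_1_1_exists:
  "\<exists>(\<Gamma> :: nat \<Rightarrow> nat pair_pre_digraph) \<Omega> \<P> \<P>' \<phi>. construction_data 1 1 \<Gamma> \<Omega> \<P> \<P>' \<phi>"
proof -
  let ?Q = "(\<lambda>x :: nat. {x}) ` {..<3}"
  have c: "card ?Q = 3" by (simp add: card_image)
  have p: "partition_on {..<3} ?Q" by (rule partition_on_singletons)
  show ?thesis
  proof (rule construction_data_three_copies[where n = 3 and k = 2 and \<nu> = 3 and R = triangle_graph
        and \<Omega> = ?Q and \<P> = ?Q and \<P>' = ?Q and h = id])
    show "\<exists>\<S> \<subseteq> \<Q>. card \<S> = 1 \<and> \<omega> = \<Union> \<S>" if "\<Q> \<in> {?Q, ?Q}" "\<omega> \<in> ?Q" for \<Q> \<omega>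
      by (rule exI[of _ "{\<omega>}"]) (use that in auto)
    show "edge_regular 3 2 1 triangle_graph" by (rule edge_regular_triangle_graph)
  qed (use c p in \<open>auto simp: triangle_graph_def independent_set_def\<close>)
qed

text \<open>
The two partitions of the \<open>3 \<times> 3\<close> grid into broken diagonals of the two directions. The swap \<open>h\<close>
of rows 1 and 2 exchanges the directions.
\<close>

lemma construction_data_1_3_exists:
  "\<exists>(\<Gamma> :: nat \<Rightarrow> nat pair_pre_digraph) \<Omega> \<P> \<P>' \<phi>. construction_data 1 3 \<Gamma> \<Omega> \<P> \<P>' \<phi>"
proof -
  define h :: "nat \<Rightarrow> nat" where
    "h x = (if x div 3 = 1 then x + 3 else if x div 3 = 2 then x - 3 else x)" for x
  define \<P> \<P>' :: "nat set set"
    where "\<P> = {{0, 5, 7}, {1, 3, 8}, {2, 4, 6}}" and "\<P>' = {{0, 4, 8}, {1, 5, 6}, {2, 3, 7}}"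
  have disj: "partition_on (A \<union> B \<union> C) {A, B, C} \<and> card {A, B, C} = 3"
    if "A \<inter> B = {}" "A \<inter> C = {}" "B \<inter> C = {}" "A \<noteq> {}" "B \<noteq> {}" "C \<noteq> {}" for A B C :: "nat set"
  proof -
    have "A \<noteq> B" "A \<noteq> C" "B \<noteq> C" using that by blast+
    then have "card {A, B, C} = 3" by simp
    moreover have "disjoint {A, B, C}"
      using that by (auto simp: pairwise_insert disjnt_def)
    ultimately show ?thesis using that by (simp add: partition_on_def Un_assoc)
  qed
  have Q: "partition_on {..<9} \<Q> \<and> card \<Q> = 3 \<and> \<Union> \<Q> = {..<9}" if "\<Q> \<in> {\<P>, \<P>'}" for \<Q>
  proof -
    have "{..<9} = {0, 5, 7} \<union> {1, 3, 8} \<union> {2, 4, 6 :: nat}" by auto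
    moreover have "{..<9} = {0, 4, 8} \<union> {1, 5, 6} \<union> {2, 3, 7 :: nat}" by auto
    ultimately have "partition_on {..<9} \<Q> \<and> card \<Q> = 3"
      using that disj[of "{0, 5, 7}" "{1, 3, 8}" "{2, 4, 6}"] disj[of "{0, 4, 8}" "{1, 5, 6}" "{2, 3, 7}"]
      unfolding \<P>_def \<P>'_def by auto
    then show ?thesis using partition_onD1 by blast
  qed
  have indep: "independent_set grid_graph A \<and> card A = 3" if "A \<in> \<P> \<union> \<P>'" for A
    using that unfolding \<P>_def \<P>'_def independent_set_def grid_graph_def by auto
  have meet: "card (A \<inter> B) = 1" if "A \<in> \<P>" "B \<in> \<P>'" for A B
    using that unfolding \<P>_def \<P>'_def by auto
  have img: "(`) h ` \<P> = \<P>'" unfolding \<P>_def \<P>'_def h_def by simp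
  have inj: "inj h"
  proof (rule inj_on_inverseI[of _ h])
    have "(x - 3) div 3 = 1" "x \<ge> 3" if "x div 3 = 2" for x :: nat using that by arith+
    then show "h (h x) = x" for x by (simp add: h_def)
  qed
  have fix_all: "h ` {..<9} = {..<9}" unfolding lessThan_9 h_def by auto
  show ?thesis
  proof (rule construction_data_three_copies[where n = 9 and k = 4 and \<nu> = 1 and R = grid_graph
        and \<Omega> = "{{..<9}}" and \<P> = \<P> and \<P>' = \<P>' and h = h])
    show "3 dvd 1 + (2 :: nat)" by (simp del: One_nat_def)
    show "edge_regular 9 4 1 grid_graph" by (rule edge_regular_grid_graph)
    show "\<exists>\<S> \<subseteq> \<Q>. card \<S> = 3 \<and> \<omega> = \<Union> \<S>" if "\<Q> \<in> {\<P>, \<P>'}" "\<omega> \<in> {{..<9}}" for \<Q> \<omega>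
      by (rule exI[of _ \<Q>]) (use that Q[OF that(1)] in auto)
    show "partition_on {..<9} {{..<9 :: nat}}"
      using partition_on_space[of "{..<9 :: nat}"] by (simp add: lessThan_9)
    show "partition_on {..<9} \<Q> \<and> card \<Q> = 3 * 1" if "\<Q> \<in> {\<P>, \<P>'}" for \<Q>
      using Q[OF that] by simp
    show "independent_set grid_graph A \<and> card A = 3 * 1" if "\<Q> \<in> {\<P>, \<P>'}" "A \<in> \<Q>" for \<Q> A
      using indep[of A] that by auto
  qed (use meet img inj fix_all in \<open>simp_all add: grid_graph_def\<close>)
qed

section \<open>The rook graph\<close>

lemma edge_regular_complete:
  assumes G: "edge_regular (Suc k) k l G" and x: "x \<in> pverts G" and y: "y \<in> pverts G"
  shows "(x, y) \<in> parcs G \<longleftrightarrow> x \<noteq> y"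
proof -
  have g: "pair_graph G" and c: "card (pverts G) = Suc k" "card (nbrs G x) = k"
    using G x by (simp_all add: edge_regular_def)
  have fin: "finite (pverts G)" by (rule pair_graphD(1)[OF g])
  have "nbrs G x \<subseteq> pverts G - {x}"
    using pair_graphD(2,3)[OF g] by (auto simp: nbrs_def)
  then have "nbrs G x = pverts G - {x}"
    by (rule card_subset_eq[rotated]) (use fin c x in simp_all)
  then show ?thesis using y by (auto simp: nbrs_def set_eq_iff)
qed

lemma partition_on_singletons_eq:
  assumes "partition_on V Q" "\<And>A. A \<in> Q \<Longrightarrow> card A = 1"
  shows "Q = (\<lambda>x. {x}) ` V"
proof (intro equalityI subsetI)
  fix A assume A: "A \<in> Q"
  then obtain x where "A = {x}" using assms(2) card_1_singletonE by blast
  then show "A \<in> (\<lambda>x. {x}) ` V" using A partition_onD1[OF assms(1)] by blast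
next
  fix A assume "A \<in> (\<lambda>x. {x}) ` V"
  then obtain x where x: "A = {x}" "x \<in> V" by blast
  then obtain B where B: "B \<in> Q" "x \<in> B" using partition_onD1[OF assms(1)] by blast
  then obtain y where "B = {y}" using assms(2) card_1_singletonE by blast
  then show "A \<in> Q" using B x by simp
qed

text \<open>
Here the three graphs are triangles and all parts are singletons, so gluing amounts to three
perfect matchings. They compose to the identity, which closes the nine cross edges to three
triangles transversal to the given ones: rows and columns of the rook graph.
\<close>

theorem Gamma_bar_1_1_rook:
  assumes data: "construction_data 1 1 \<Gamma> \<Omega> \<P> \<P>' \<phi>"
  shows "graph_iso (Gamma_bar \<Gamma> \<P> \<phi>) rook_graph_3_3"
proof -
  interpret glued "1 * 1 * (1 + 2)" "1 * (1 + 1)" 1 "1 * 1" \<Gamma> \<P> \<P>' \<phi>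
    by (rule construction_data_glued[OF data])
  have complete: "(x, y) \<in> parcs (\<Gamma> i) \<longleftrightarrow> x \<noteq> y"
    if "i \<in> {1, 2, 3}" "x \<in> V i" "y \<in> V i" for i x y
    by (rule edge_regular_complete[of 2 1]) (use regular[OF that(1)] that in \<open>simp_all add: numeral_eq_Suc\<close>)
  have singles: "\<P> i = (\<lambda>x. {x}) ` V i" "\<P>' i = (\<lambda>x. {x}) ` V i" "\<Omega> i = (\<lambda>x. {x}) ` V i"
    if i: "i \<in> {1, 2, 3}" for i
  proof -
    have c: "card A = 1" if "A \<in> \<P> i \<union> \<P>' i" for A
      using independent[OF i that] by simp
    show "\<P> i = (\<lambda>x. {x}) ` V i"
      by (rule partition_on_singletons_eq[OF partition(1)[OF i]]) (rule c, blast)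
    show "\<P>' i = (\<lambda>x. {x}) ` V i"
      by (rule partition_on_singletons_eq[OF partition(2)[OF i]]) (rule c, blast)
    show "\<Omega> i = (\<lambda>x. {x}) ` V i"
      by (rule partition_on_singletons_eq[OF construction_dataD(3)[OF data i]])
        (use construction_dataD(5)[OF data i] in simp)
  qed
  define g where "g i x = the_elem (\<phi> i {x})" for i x
  have g: "\<phi> i {x} = {g i x}" "g i x \<in> V (succ3 i)" if i: "i \<in> {1, 2, 3}" and x: "x \<in> V i" for i x
  proof -
    have "\<phi> i {x} \<in> \<P>' (succ3 i)"
      by (rule glued_part[OF i]) (unfold singles(1)[OF i], rule imageI[OF x])
    then obtain y where "\<phi> i {x} = {y}" "y \<in> V (succ3 i)"
      unfolding singles(2)[OF succ3_simps(1)[OF i]] by blast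
    then show "\<phi> i {x} = {g i x}" "g i x \<in> V (succ3 i)"
      by (simp_all add: g_def)
  qed
  have g_bij: "bij_betw (g i) (V i) (V (succ3 i))" if i: "i \<in> {1, 2, 3}" for i
  proof -
    have b: "bij_betw (\<phi> i) ((\<lambda>x. {x}) ` V i) ((\<lambda>x. {x}) ` V (succ3 i))"
      using glue[OF i] singles(1)[OF i] singles(2)[OF succ3_simps(1)[OF i]] by simp
    have "inj_on (g i) (V i)"
    proof (rule inj_onI)
      fix x y assume xy: "x \<in> V i" "y \<in> V i" "g i x = g i y"
      then have "\<phi> i {x} = \<phi> i {y}" using g(1)[OF i] by simp
      then have "{x} = {y}"
        by (rule inj_onD[OF bij_betw_imp_inj_on[OF b]]) (use xy in simp_all)
      then show "x = y" by simp
    qed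
    moreover have "V (succ3 i) \<subseteq> g i ` V i"
    proof
      fix y assume "y \<in> V (succ3 i)"
      then have "{y} \<in> \<phi> i ` ((\<lambda>x. {x}) ` V i)" using bij_betw_imp_surj_on[OF b] by simp
      then obtain x where "x \<in> V i" "\<phi> i {x} = {y}" by force
      then show "y \<in> g i ` V i" using g(1)[OF i] by force
    qed
    ultimately show ?thesis using g(2)[OF i] by (auto simp: bij_betw_def)
  qed
  have cross: "(x, y) \<in> cross_arcs (\<P> i) (\<phi> i) \<longleftrightarrow> y = g i x" if "i \<in> {1, 2, 3}" "x \<in> V i" for i x y
    using that g(1)[OF that] singles(1)[OF that(1)] by (auto simp: cross_arcs_def)
  have induced: "induced_map (\<P> i) (\<phi> i) {x} = {g i x}" if "i \<in> {1, 2, 3}" "x \<in> V i" for i x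
  proof -
    have "{A \<in> \<P> i. A \<subseteq> {x}} = {{x}}" using singles(1)[OF that(1)] that(2) by auto
    then show ?thesis using g(1)[OF that] by (simp add: induced_map_def)
  qed
  have cycle: "g 3 (g 2 (g 1 x)) = x" if x: "x \<in> V 1" for x
  proof -
    have 2: "g 1 x \<in> V 2" using g(2)[of 1 x] x by (simp add: succ3_values)
    then have 3: "g 2 (g 1 x) \<in> V 3" using g(2)[of 2 "g 1 x"] by (simp add: succ3_values)
    have "{x} \<in> \<Omega> 1" using singles(3)[of 1] x by simp
    then have "induced_map (\<P> 3) (\<phi> 3) (induced_map (\<P> 2) (\<phi> 2) (induced_map (\<P> 1) (\<phi> 1) {x})) = {x}"
      using data unfolding construction_data_def Let_def by (elim conjE) (rule bspec)
    then show ?thesis using induced[of 1 x] induced[of 2 "g 1 x"] induced[of 3 "g 2 (g 1 x)"] x 2 3 by simp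
  qed
  have arc: "(x, y) \<in> parcs G \<longleftrightarrow>
      (if i = j then x \<noteq> y else if j = succ3 i then y = g i x else x = g j y)"
    if i: "i \<in> {1, 2, 3}" and j: "j \<in> {1, 2, 3}" and x: "x \<in> V i" and y: "y \<in> V j" for i j x y
  proof -
    have within: "(x, y) \<in> parcs (\<Gamma> h) \<longleftrightarrow> h = i \<and> h = j \<and> x \<noteq> y" if h: "h \<in> {1, 2, 3}" for h
    proof
      assume a: "(x, y) \<in> parcs (\<Gamma> h)"
      then have "x \<in> V h" "y \<in> V h" using pair_graphD(2)[OF graph[OF h]] by blast+
      then show "h = i \<and> h = j \<and> x \<noteq> y"
        using same_index[OF _ x h i] same_index[OF _ y h j] a complete[OF h, of x y] by blast
    qed (use complete[OF h, of x y] x y in blast)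
    have fwd: "(x, y) \<in> cross_arcs (\<P> h) (\<phi> h) \<longleftrightarrow> h = i \<and> y = g h x" if h: "h \<in> {1, 2, 3}" for h
      using cross_verts(1)[OF h, of x y] same_index[OF _ x h i] cross[OF h, of x y] x by blast
    have bwd: "(y, x) \<in> cross_arcs (\<P> h) (\<phi> h) \<longleftrightarrow> h = j \<and> x = g h y" if h: "h \<in> {1, 2, 3}" for h
      using cross_verts(1)[OF h, of y x] same_index[OF _ y h j] cross[OF h, of y x] y by blast
    have out: "y = g i x \<Longrightarrow> j = succ3 i"
      using same_index[OF y _ j succ3_simps(1)[OF i]] g(2)[OF i x] by blast
    have inn: "x = g j y \<Longrightarrow> i = succ3 j"
      using same_index[OF x _ i succ3_simps(1)[OF j]] g(2)[OF j y] by blast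
    have pick: "i \<in> I \<Longrightarrow> j \<in> I \<Longrightarrow> (\<exists>h \<in> I.
        h = i \<and> h = j \<and> x \<noteq> y \<or> h = i \<and> y = g h x \<or> h = j \<and> x = g h y) \<longleftrightarrow>
        i = j \<and> x \<noteq> y \<or> y = g i x \<or> x = g j y" for I
      by auto
    have "(x, y) \<in> parcs G \<longleftrightarrow> (\<exists>h \<in> {1, 2, 3}.
        h = i \<and> h = j \<and> x \<noteq> y \<or> h = i \<and> y = g h x \<or> h = j \<and> x = g h y)"
      unfolding arcs_G by (intro bex_cong refl) (simp only: within fwd bwd)
    also have "\<dots> \<longleftrightarrow> i = j \<and> x \<noteq> y \<or> y = g i x \<or> x = g j y" by (rule pick[OF i j])
    finally have *: "(x, y) \<in> parcs G \<longleftrightarrow> i = j \<and> x \<noteq> y \<or> y = g i x \<or> x = g j y" .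
    note ne = succ3_simps(3,4)[OF i]
    consider "i = j" | "i \<noteq> j" "j = succ3 i" | "i \<noteq> j" "j \<noteq> succ3 i" by blast
    then show ?thesis
    proof cases
      case 1
      then have "y \<noteq> g i x" "x \<noteq> g j y" using out inn ne by metis+
      with * 1 show ?thesis by auto
    next
      case 2
      then have "x \<noteq> g j y" using inn ne by metis
      with * 2 show ?thesis by simp
    next
      case 3
      then have "y \<noteq> g i x" using out by blast
      with * 3 show ?thesis by simp
    qed
  qed
  have "card (V 1) = 3" using regular[of 1] by (simp add: edge_regular_def numeral_eq_Suc)
  then obtain e where e: "bij_betw e {0..<3 :: nat} (V 1)"
    using ex_bij_betw_nat_finite[OF finite_V[of 1]] by auto
  \<comment> \<open>The rook graph is mapped with row \<open>r\<close> onto graph \<open>r + 1\<close> and columns along the matchings.\<close>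
  define row where "row r = (if r = 0 then e else if r = 1 then g 1 \<circ> e else g 2 \<circ> (g 1 \<circ> e))" for r :: nat
  have row_bij: "bij_betw (row r) {0..<3} (V (r + 1))" if "r < 3" for r
  proof -
    have "bij_betw (g 1 \<circ> e) {0..<3} (V 2)"
      using bij_betw_trans[OF e, of "g 1" "V 2"] g_bij[of 1] by (simp add: succ3_values del: One_nat_def)
    moreover from this have "bij_betw (g 2 \<circ> (g 1 \<circ> e)) {0..<3} (V 3)"
      using bij_betw_trans[of "g 1 \<circ> e" "{0..<3}" "V 2" "g 2" "V 3"] g_bij[of 2] by (simp add: succ3_values del: One_nat_def)
    moreover have "r = 0 \<or> r = 1 \<or> r = 2" using that by auto
    ultimately show ?thesis
      using e by (elim disjE) (simp_all add: row_def del: One_nat_def)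
  qed
  \<comment> \<open>The case \<open>r = 2\<close> is the one that needs the composed matchings to be the identity.\<close>
  have step: "g (r + 1) (row r c) = row (succ3 (r + 1) - 1) c" if "r < 3" "c < 3" for r c
  proof -
    have "e c \<in> V 1" using bij_betw_apply[OF e] that by simp
    moreover have "r = 0 \<or> r = 1 \<or> r = 2" using that by auto
    ultimately show ?thesis
      using cycle[of "e c"] by (elim disjE) (simp_all add: row_def succ3_values del: One_nat_def)
  qed
  define F where "F = (\<lambda>(r, c). row r c)"
  have "graph_bij F rook_graph_3_3 G"
    unfolding graph_bij_def
  proof (intro conjI ballI)
    have V: "pverts rook_graph_3_3 = {0..<3} \<times> {0..<3}"
      by (simp add: rook_graph_3_3_def cartesian_product_def complete_graph_def)
    have rook: "((r, c), (r', c')) \<in> parcs rook_graph_3_3 \<longleftrightarrow> r = r' \<and> c \<noteq> c' \<or> r \<noteq> r' \<and> c = c'"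
      if "r < 3" "c < 3" "r' < 3" "c' < 3" for r c r' c'
      using that by (auto simp: rook_graph_3_3_def cartesian_product_def complete_graph_def)
    have FV: "F (r, c) \<in> V (r + 1)" if "r < 3" "c < 3" for r c
      using bij_betw_apply[OF row_bij] that by (simp add: F_def)
    have row_inj: "row r c = row r c' \<longleftrightarrow> c = c'" if "r < 3" "c < 3" "c' < 3" for r c c'
      using bij_betw_imp_inj_on[OF row_bij[OF that(1)]] that by (simp add: inj_on_eq_iff)
    have idx: "r + 1 \<in> {1, 2, 3}" if "r < 3" for r :: nat using that by auto
    show "bij_betw F (pverts rook_graph_3_3) (pverts G)"
    proof (rule bij_betw_imageI)
      show "inj_on F (pverts rook_graph_3_3)"
      proof (rule inj_onI, unfold V, clarify)
        fix r c r' c' assume a: "r \<in> {0..<3}" "c \<in> {0..<3}" "r' \<in> {0..<3}" "c' \<in> {0..<3}"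
          and eq: "F (r, c) = F (r', c')"
        then have lt: "r < 3" "c < 3" "r' < 3" "c' < 3" by simp_all
        have "r + 1 = r' + 1"
          by (rule same_index[OF FV[OF lt(1,2)] _ idx[OF lt(1)] idx[OF lt(3)]])
            (unfold eq, rule FV[OF lt(3,4)])
        then have r: "r = r'" by simp
        then have "row r c = row r c'" using eq by (simp add: F_def)
        then show "r = r' \<and> c = c'" using r row_inj[OF lt(1,2,4)] by simp
      qed
      show "F ` pverts rook_graph_3_3 = pverts G"
      proof
        have sub: "V i \<subseteq> pverts G" if "i \<in> {1, 2, 3}" for i
          using that by (auto simp: verts_G)
        show "F ` pverts rook_graph_3_3 \<subseteq> pverts G"
        proof (rule image_subsetI, unfold V, clarify)
          fix r c :: nat assume "r \<in> {0..<3}" "c \<in> {0..<3}"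
          then have lt: "r < 3" "c < 3" by simp_all
          show "F (r, c) \<in> pverts G" using FV[OF lt] sub[OF idx[OF lt(1)]] by (rule rev_subsetD)
        qed
        show "pverts G \<subseteq> F ` pverts rook_graph_3_3"
        proof
          fix x assume "x \<in> pverts G"
          then obtain i where i: "i \<in> {1, 2, 3}" "x \<in> V i" by (auto simp: verts_G)
          then obtain r where r: "r < 3" "i = r + 1" by (auto intro: that[of "i - 1"])
          then have "x \<in> row r ` {0..<3}" using i bij_betw_imp_surj_on[OF row_bij] by blast
          then show "x \<in> F ` pverts rook_graph_3_3" using r unfolding V F_def by force
        qed
      qed
    qed
    fix p q assume p: "p \<in> pverts rook_graph_3_3" and q: "q \<in> pverts rook_graph_3_3"
    obtain r c r' c' where pq: "p = (r, c)" "q = (r', c')" by (metis surj_pair)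
    have rc: "r < 3" "c < 3" "r' < 3" "c' < 3" using p q by (simp_all add: V pq)
    have FG: "(F p, F q) \<in> parcs G \<longleftrightarrow> (if r + 1 = r' + 1 then row r c \<noteq> row r' c'
        else if r' + 1 = succ3 (r + 1) then row r' c' = g (r + 1) (row r c)
        else row r c = g (r' + 1) (row r' c'))"
      using arc[OF idx[OF rc(1)] idx[OF rc(3)] FV[OF rc(1,2)] FV[OF rc(3,4)]]
      unfolding pq F_def prod.case .
    have R: "(p, q) \<in> parcs rook_graph_3_3 \<longleftrightarrow> r = r' \<and> c \<noteq> c' \<or> r \<noteq> r' \<and> c = c'"
      unfolding pq by (rule rook[OF rc])
    consider "r = r'" | "r \<noteq> r'" "r' + 1 = succ3 (r + 1)"
      | "r \<noteq> r'" "r' + 1 \<noteq> succ3 (r + 1)" "r + 1 = succ3 (r' + 1)"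
    proof -
      have "r \<in> {0, 1, 2}" "r' \<in> {0, 1, 2}" using rc by auto
      then have "r = r' \<or> r' + 1 = succ3 (r + 1) \<or> r' + 1 \<noteq> succ3 (r + 1) \<and> r + 1 = succ3 (r' + 1)"
        by (elim insertE emptyE) (simp_all add: succ3_def del: One_nat_def)
      then show thesis using that by blast
    qed
    then show "(p, q) \<in> parcs rook_graph_3_3 \<longleftrightarrow> (F p, F q) \<in> parcs G"
    proof cases
      case 1
      then show ?thesis unfolding FG R using row_inj[OF rc(1,2,4)] by simp
    next
      case 2
      then have "g (r + 1) (row r c) = row r' c"
        using step[OF rc(1,2)] unfolding 2(2)[symmetric] by simp
      then show ?thesis unfolding FG R using 2 row_inj[OF rc(3,4,2)] by auto
    next
      case 3
      then have "g (r' + 1) (row r' c') = row r c'"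
        using step[OF rc(3,4)] unfolding 3(3)[symmetric] by simp
      then show ?thesis unfolding FG R using 3 row_inj[OF rc(1,2,4)] by simp
    qed
  qed
  then have "graph_bij (the_inv_into (pverts rook_graph_3_3) F) G rook_graph_3_3"
    by (rule graph_bij_inverse)
  moreover have "pair_wf_digraph rook_graph_3_3"
    by unfold_locales (auto simp: rook_graph_3_3_def cartesian_product_def complete_graph_def)
  ultimately show ?thesis
    using graph_iso_if_graph_bij[OF pair_graphD(5)[OF pair_graph_G]] by blast
qed

section \<open>Conclusion\<close>

theorem mainTheorem4:
  shows
    "(\<exists>(\<Gamma> :: nat \<Rightarrow> nat pair_pre_digraph) \<Omega> \<P> \<P>' \<phi>. construction_data 1 1 \<Gamma> \<Omega> \<P> \<P>' \<phi>) \<and>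
     (\<forall>(\<Gamma> :: nat \<Rightarrow> 'a pair_pre_digraph) \<Omega> \<P> \<P>' \<phi>.
        construction_data 1 1 \<Gamma> \<Omega> \<P> \<P>' \<phi> \<longrightarrow>
        graph_iso (Gamma_bar \<Gamma> \<P> \<phi>) rook_graph_3_3) \<and>
     (\<exists>(\<Gamma> :: nat \<Rightarrow> nat pair_pre_digraph) \<Omega> \<P> \<P>' \<phi>.
        construction_data 1 3 \<Gamma> \<Omega> \<P> \<P>' \<phi> \<and> neumaier_graph (Gamma_bar \<Gamma> \<P> \<phi>)) \<and>
     (\<exists>(S :: nat pair_pre_digraph) (X :: nat set) \<L>.
        (strongly_regular 27 10 1 5 S \<and>
         (\<forall>H :: 'b pair_pre_digraph. strongly_regular 27 10 1 5 H \<longrightarrow> graph_iso H S)) \<and>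
        (generalized_quadrangle 2 4 X \<L> \<and>
         (\<forall>(Y :: 'c set) \<M>. generalized_quadrangle 2 4 Y \<M> \<longrightarrow> incidence_iso Y \<M> X \<L>)) \<and>
        graph_iso S (collinearity_graph X \<L>) \<and>
        (\<forall>(\<Gamma> :: nat \<Rightarrow> 'a pair_pre_digraph) \<Omega> \<P> \<P>' \<phi>.
           construction_data 1 3 \<Gamma> \<Omega> \<P> \<P>' \<phi> \<and> neumaier_graph (Gamma_bar \<Gamma> \<P> \<phi>) \<longrightarrow>
           graph_iso (Gamma_bar \<Gamma> \<P> \<phi>) S))"
proof (intro conjI)
  show "\<exists>(\<Gamma> :: nat \<Rightarrow> nat pair_pre_digraph) \<Omega> \<P> \<P>' \<phi>. construction_data 1 1 \<Gamma> \<Omega> \<P> \<P>' \<phi>"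
    by (rule construction_data_1_1_exists)
  show "\<forall>(\<Gamma> :: nat \<Rightarrow> 'a pair_pre_digraph) \<Omega> \<P> \<P>' \<phi>.
      construction_data 1 1 \<Gamma> \<Omega> \<P> \<P>' \<phi> \<longrightarrow> graph_iso (Gamma_bar \<Gamma> \<P> \<phi>) rook_graph_3_3"
    by (intro allI impI) (rule Gamma_bar_1_1_rook)
  obtain \<Gamma> :: "nat \<Rightarrow> nat pair_pre_digraph" and \<Omega> \<P> \<P>' \<phi>
    where data: "construction_data 1 3 \<Gamma> \<Omega> \<P> \<P>' \<phi>"
    using construction_data_1_3_exists by blast
  define S where "S = Gamma_bar \<Gamma> \<P> \<phi>"
  have regular: "edge_regular 27 10 1 S"
    unfolding S_def by (rule edge_regular_Gamma_bar_1_3[OF data])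
  interpret edge_regular_27_10_1 S by unfold_locales (rule regular)
  show "\<exists>(\<Gamma> :: nat \<Rightarrow> nat pair_pre_digraph) \<Omega> \<P> \<P>' \<phi>.
      construction_data 1 3 \<Gamma> \<Omega> \<P> \<P>' \<phi> \<and> neumaier_graph (Gamma_bar \<Gamma> \<P> \<phi>)"
    using data neumaier unfolding S_def by blast
  have "strongly_regular 27 10 1 5 S \<and>
      (\<forall>H :: 'b pair_pre_digraph. strongly_regular 27 10 1 5 H \<longrightarrow> graph_iso H S)"
  proof (intro conjI allI impI)
    fix H :: "'b pair_pre_digraph" assume "strongly_regular 27 10 1 5 H"
    then have "edge_regular 27 10 1 H" by (simp add: strongly_regular_def)
    then show "graph_iso H S" using regular by (rule edge_regular_27_10_1_iso)
  qed (rule strongly_regular)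
  moreover have "generalized_quadrangle 2 4 (pverts S) (triangles S) \<and>
      (\<forall>(Y :: 'c set) \<M>. generalized_quadrangle 2 4 Y \<M> \<longrightarrow>
        incidence_iso Y \<M> (pverts S) (triangles S))"
  proof (intro conjI allI impI)
    fix Y :: "'c set" and \<M> assume "generalized_quadrangle 2 4 Y \<M>"
    then show "incidence_iso Y \<M> (pverts S) (triangles S)"
      using regular by (rule generalized_quadrangle_2_4_unique)
  qed (rule generalized_quadrangle_triangles)
  moreover have "graph_iso S (collinearity_graph (pverts S) (triangles S))"
    unfolding collinearity_graph_triangles by (rule edge_regular_27_10_1_iso[OF regular regular])
  moreover have "\<forall>(\<Gamma> :: nat \<Rightarrow> 'a pair_pre_digraph) \<Omega> \<P> \<P>' \<phi>.
      construction_data 1 3 \<Gamma> \<Omega> \<P> \<P>' \<phi> \<and> neumaier_graph (Gamma_bar \<Gamma> \<P> \<phi>) \<longrightarrow>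
      graph_iso (Gamma_bar \<Gamma> \<P> \<phi>) S"
  proof (intro allI impI, elim conjE)
    fix \<Gamma> :: "nat \<Rightarrow> 'a pair_pre_digraph" and \<Omega> \<P> \<P>' \<phi>
    assume "construction_data 1 3 \<Gamma> \<Omega> \<P> \<P>' \<phi>"
    then have "edge_regular 27 10 1 (Gamma_bar \<Gamma> \<P> \<phi>)" by (rule edge_regular_Gamma_bar_1_3)
    then show "graph_iso (Gamma_bar \<Gamma> \<P> \<phi>) S" using regular by (rule edge_regular_27_10_1_iso)
  qed
  ultimately show "\<exists>(S :: nat pair_pre_digraph) (X :: nat set) \<L>.
      (strongly_regular 27 10 1 5 S \<and>
       (\<forall>H :: 'b pair_pre_digraph. strongly_regular 27 10 1 5 H \<longrightarrow> graph_iso H S)) \<and>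
      (generalized_quadrangle 2 4 X \<L> \<and>
       (\<forall>(Y :: 'c set) \<M>. generalized_quadrangle 2 4 Y \<M> \<longrightarrow> incidence_iso Y \<M> X \<L>)) \<and>
      graph_iso S (collinearity_graph X \<L>) \<and>
      (\<forall>(\<Gamma> :: nat \<Rightarrow> 'a pair_pre_digraph) \<Omega> \<P> \<P>' \<phi>.
         construction_data 1 3 \<Gamma> \<Omega> \<P> \<P>' \<phi> \<and> neumaier_graph (Gamma_bar \<Gamma> \<P> \<phi>) \<longrightarrow>
         graph_iso (Gamma_bar \<Gamma> \<P> \<phi>) S)"
    by blast
qed

end
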